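(* Fix $a\ge1$ and $b\ge1$, and let $q_n=p_{n,(a,b)}$. Then $q_n$ satisfies $q_n=p_{n,(a,a+b)}\boxtimes_n(e_{\boxtimes_n}\boxplus_nq_n)$ with $e_{\boxtimes_n}(z)=(z-1)^n$, and, as $n\to\infty$, (i) $\mu[p_{n,(a,a+b)}]$ converges weakly to $\mu_{\mathbb{A}}:=f\mathcal{B}'_{a,a+b}$, (ii) $\mu[q_n]$ converges weakly to $\mu_{\mathbb{X}}:=f\mathcal{B}'_{a,b}$. Moreover, $$\mu_{\mathbb{X}}=\mu_{\mathbb{A}}\boxtimes(\delta_1\boxplus\mu_{\mathbb{X}}).$$
   Context: Rising factorial: $(x)_0=1$, $(x)_k=x(x+1)\cdots(x+k-1)$. For $n\in\mathbb{N}$ every complex polynomial $p$ of degree at most $n$ is written uniquely as $p(z)=\sum_{k=0}^n(-1)^k\binom nk\widetilde{\mathsf e}_k^{(n)}(p)z^{n-k}$. For polynomials $p,q$ of degree at most $n$, the finite free convolutions $p\boxplus_nq$ and $p\boxtimes_nq$ are the polynomials of degree at most $n$ with $\widetilde{\mathsf e}_k^{(n)}(p\boxplus_nq)=\sum_{j=0}^k\binom kj\widetilde{\mathsf e}_j^{(n)}(p)\widetilde{\mathsf e}_{k-j}^{(n)}(q)$ and $\widetilde{\mathsf e}_k^{(n)}(p\boxtimes_nq)=\widetilde{\mathsf e}_k^{(n)}(p)\widetilde{\mathsf e}_k^{(n)}(q)$, $k=0,\dots,n$. For $b>1$, $p_{n,(a,b)}$ is the monic polynomial of degree $n$ with $\widetilde{\mathsf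 e}_k^{(n)}(p_{n,(a,b)})=(-1)^k\frac{(-an)_k}{((b-1)n)_k}$, $k=0,\dots,n$. For $b=1$, $p_{n,(a,1)}$ is the monic polynomial of degree $n-1$ defined by $p_{n,(a,1)}(z)=\lim_{b\to1}\frac{p_{n,(a,b)}(z)}{-n\,\widetilde{\mathsf e}_1^{(n)}(p_{n,(a,b)})}$ (its empirical root distribution is considered for $n\ge2$). For a polynomial $p$ of degree $m\ge1$ with roots $\lambda_1,\dots,\lambda_m$ (with multiplicity), $\mu[p]=\frac1m\sum_{i=1}^m\delta_{\lambda_i}$. $\boxplus$ is the free additive convolution of probability measures on $\mathbb{R}$ (so $\delta_1\boxplus\mu$ is the translate of $\mu$ by $1$). For a probability measure $\mu\ne\delta_0$ on $\mathbb{R}_{\ge0}$, the $S$-transform is $S_\mu(z)=\frac{1+z}{z}\Psi_\mu^{-1}(z)$, $z\in(-1+\mu(\{0\}),0)$, with $\Psi_\mu(z)=\int_0^\infty\frac{tz}{1-tz}\mu(dt)$; $\mu\boxtimes\nu$ (free multiplicative convolution) is the unique probability measure on $\mathbb{R}_{\ge0}$ with $S_{\mu\boxtimes\nu}=S_\mu S_\nu$. For $a>0$, $b\ge1$, $f\mathcal{B}'_{a,b}$ is the unique probability measure on $\mathbb{R}_{\ge0}$ with $S_{f\mathcal{B}'_{a,b}}(z)=\frac{b-1-z}{a+z}$, $z\in(-\min\{a,1\},0)$. *)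

theory Defs
  imports "HOL-Probability.Probability"
begin

section \<open>Finite free convolutions\<close>

definition norm_coeff :: "nat \<Rightarrow> complex poly \<Rightarrow> nat \<Rightarrow> complex" where
  "norm_coeff n p k = (-1) ^ k * coeff p (n - k) / of_nat (n choose k)"

definition poly_of_norm_coeffs :: "nat \<Rightarrow> (nat \<Rightarrow> complex) \<Rightarrow> complex poly" where
  "poly_of_norm_coeffs n e = (\<Sum>k\<le>n. monom ((-1) ^ k * of_nat (n choose k) * e k) (n - k))"

definition finite_free_add :: "nat \<Rightarrow> complex poly \<Rightarrow> complex poly \<Rightarrow> complex poly" where
  "finite_free_add n p q = poly_of_norm_coeffs n
     (\<lambda>k. \<Sum>j\<le>k. of_nat (k choose j) * norm_coeff n p j * norm_coeff n q (k - j))"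

definition finite_free_mult :: "nat \<Rightarrow> complex poly \<Rightarrow> complex poly \<Rightarrow> complex poly" where
  "finite_free_mult n p q = poly_of_norm_coeffs n (\<lambda>k. norm_coeff n p k * norm_coeff n q k)"

definition finite_free_unit :: "nat \<Rightarrow> complex poly" where
  "finite_free_unit n = [:-1, 1:] ^ n"


section \<open>The polynomials $p_{n,(a,b)}$\<close>

definition hyp_poly_gt1 :: "nat \<Rightarrow> real \<Rightarrow> real \<Rightarrow> complex poly" where
  "hyp_poly_gt1 n a b = poly_of_norm_coeffs n
     (\<lambda>k. (-1) ^ k * complex_of_real (pochhammer (- a * real n) k / pochhammer ((b - 1) * real n) k))"

text \<open>For \<open>b = 1\<close> the limit is from the right, since the polynomials are defined for \<open>b > 1\<close>.
  The description is unambiguous because a complex polynomial is determined by its values.\<close>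

definition hyp_poly :: "nat \<Rightarrow> real \<Rightarrow> real \<Rightarrow> complex poly" where
  "hyp_poly n a b =
     (if b > 1 then hyp_poly_gt1 n a b
      else (THE p. \<forall>z. ((\<lambda>b'. poly (hyp_poly_gt1 n a b') z /
                (- of_nat n * norm_coeff n (hyp_poly_gt1 n a b') 1)) \<longlongrightarrow> poly p z) (at_right 1)))"


section \<open>Empirical root distributions\<close>

text \<open>The uniform distribution on the roots counted with multiplicity. It is used for nonconstant
  polynomials all of whose roots are real; \<open>Re\<close> then merely transports the roots
  from the type \<open>complex\<close> to the type \<open>real\<close>.\<close>

definition root_distribution :: "complex poly \<Rightarrow> real measure" where
  "root_distribution p = distr (measure_pmf (pmf_of_multiset (proots p))) borel Re"


section \<open>Free additive convolution\<close>

definition cauchy_transform :: "real measure \<Rightarrow> complex \<Rightarrow> complex" where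
  "cauchy_transform \<mu> z = (LINT t|\<mu>. 1 / (z - complex_of_real t))"

definition recip_cauchy_transform :: "real measure \<Rightarrow> complex \<Rightarrow> complex" where
  "recip_cauchy_transform \<mu> z = 1 / cauchy_transform \<mu> z"

definition truncated_cone :: "real \<Rightarrow> real \<Rightarrow> complex set" where
  "truncated_cone \<alpha> \<beta> = {z. \<beta> < Im z \<and> \<bar>Re z\<bar> < \<alpha> * Im z}"

text \<open>The Voiculescu transform \<open>\<phi>(z) = F\<inverse>(z) - z\<close>, where \<open>F\<close> is the reciprocal Cauchy transform.
  For every \<open>\<alpha> > 0\<close> it exists on \<open>truncated_cone \<alpha> \<beta>\<close> for all sufficiently large \<open>\<beta>\<close>;
  the condition \<open>\<phi>(z) = o(z)\<close> singles out the branch of the inverse of \<open>F\<close> near infinity.\<close>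

definition is_voiculescu_transform ::
    "real measure \<Rightarrow> real \<Rightarrow> real \<Rightarrow> (complex \<Rightarrow> complex) \<Rightarrow> bool" where
  "is_voiculescu_transform \<mu> \<alpha> \<beta> \<phi> \<longleftrightarrow>
     \<phi> holomorphic_on truncated_cone \<alpha> \<beta> \<and>
     (\<forall>z\<in>truncated_cone \<alpha> \<beta>. Im (z + \<phi> z) > 0 \<and> recip_cauchy_transform \<mu> (z + \<phi> z) = z) \<and>
     ((\<lambda>z. \<phi> z / z) \<longlongrightarrow> 0) (inf at_infinity (principal (truncated_cone \<alpha> \<beta>)))"

text \<open>The Voiculescu transform linearizes free additive convolution and determines the measure.\<close>

definition free_add_conv :: "real measure \<Rightarrow> real measure \<Rightarrow> real measure" where
  "free_add_conv \<mu> \<nu> = (THE \<rho>. real_distribution \<rho> \<and>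
     (\<exists>\<alpha> \<beta> \<phi> \<psi>. \<alpha> > 0 \<and> \<beta> > 0 \<and>
        is_voiculescu_transform \<mu> \<alpha> \<beta> \<phi> \<and>
        is_voiculescu_transform \<nu> \<alpha> \<beta> \<psi> \<and>
        is_voiculescu_transform \<rho> \<alpha> \<beta> (\<lambda>z. \<phi> z + \<psi> z)))"


section \<open>Free multiplicative convolution on the half-line\<close>

definition nonneg_distribution :: "real measure \<Rightarrow> bool" where
  "nonneg_distribution \<mu> \<longleftrightarrow> real_distribution \<mu> \<and> (AE t in \<mu>. 0 \<le> t)"

definition Psi_transform :: "real measure \<Rightarrow> real \<Rightarrow> real" where
  "Psi_transform \<mu> z = (LINT t:{0..}|\<mu>. t * z / (1 - t * z))"

definition S_domain :: "real measure \<Rightarrow> real set" where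
  "S_domain \<mu> = {-1 + measure \<mu> {0} <..< 0}"

text \<open>For \<open>\<mu> \<noteq> \<delta>\<^sub>0\<close> the map \<open>Psi_transform \<mu>\<close> is a bijection from the negative half-line
  onto \<open>S_domain \<mu>\<close>; the value of \<open>S_transform \<mu>\<close> outside \<open>S_domain \<mu>\<close> carries no meaning.\<close>

definition S_transform :: "real measure \<Rightarrow> real \<Rightarrow> real" where
  "S_transform \<mu> z = (1 + z) / z * the_inv_into {..<0} (Psi_transform \<mu>) z"

text \<open>The identity \<open>S\<^sub>\<rho> = S\<^sub>\<mu> S\<^sub>\<nu>\<close> is one of partial functions, so it includes equality of the domains.\<close>

definition free_mult_conv :: "real measure \<Rightarrow> real measure \<Rightarrow> real measure" where
  "free_mult_conv \<mu> \<nu> = (THE \<rho>. nonneg_distribution \<rho> \<and>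
     S_domain \<rho> = S_domain \<mu> \<inter> S_domain \<nu> \<and>
     (\<forall>z\<in>S_domain \<rho>. S_transform \<rho> z = S_transform \<mu> z * S_transform \<nu> z))"

definition free_beta_prime :: "real \<Rightarrow> real \<Rightarrow> real measure" where
  "free_beta_prime a b = (THE \<mu>. nonneg_distribution \<mu> \<and>
     S_domain \<mu> = {- min a 1 <..< 0} \<and>
     (\<forall>z\<in>S_domain \<mu>. S_transform \<mu> z = (b - 1 - z) / (a + z)))"

end

theory Submission
  imports Defs "HOL-Complex_Analysis.Complex_Analysis"
    "HOL-Computational_Algebra.Fundamental_Theorem_Algebra"
begin

text \<open>For every \<open>b \<ge> 1\<close> the polynomial \<open>p\<^bsub>n,(a,b)\<^esub>\<close> is a multiple of the polynomial factor in
  the \<open>n\<close>-th derivative of \<open>t\<^bsup>an\<^esup> (1 + t)\<^bsup>-(a+b-1)n\<^esup>\<close>, also at \<open>b = 1\<close>. Differentiating step by step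
  and arguing as in the Gauss--Lucas theorem shows that its roots are positive; its hypergeometric equation
  is a Riccati equation for \<open>\<Psi>\<close> of the root distribution, which up to \<open>O(1/n)\<close> is the quadratic
  equation \<open>\<Psi>\<inverse>(u) = u (b - 1 - u) / ((1 + u) (a + u))\<close> of \<open>f\<B>'\<^bsub>a,b\<^esub>\<close>. Pointwise convergence of
  \<open>\<Psi>\<close> on the negative half-line with limit \<open>0\<close> at \<open>0\<close> gives tightness and hence weak convergence,
  and the existence of \<open>f\<B>'\<^bsub>a,b\<^esub>\<close>. The finite free identity is Chu--Vandermonde. In the limit, convolving
  with \<open>\<delta>\<^sub>1\<close> is a translation, which acts on \<open>\<Psi>\<close> by a Moebius substitution, so
  the \<open>S\<close>-transform of the translate is \<open>(b - 1 - z) / (a + b - 1 - z)\<close>.\<close>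


section \<open>Cauchy transforms\<close>

text \<open>The case b = 1 shapes the argument. There the limit law has S-transform
  \<open>- z / (a + z)\<close>, which vanishes at 0, so its mean is infinite and neither moments nor
  power series at infinity are available; the estimates are made where the kernels stay bounded, on
  the negative half-line and in nontangential cones. At b = 1 also the degree drops to n - 1 and the
  normalized coefficients have a pole, so the polynomials are handled through a scalar multiple that
  is regular in b. The second obstacle is that the free beta prime law and both free convolutions
  are definite descriptions: each calls for a measure with the prescribed transform and for its
  uniqueness, which rests on Stieltjes inversion. The quadratic for \<open>x = 1 + \<Psi>\<close>
  has opposite signs at 0 and 1, hence exactly one zero between them, and a stable one. This selects
  the branch and absorbs the error O(1/n) at the same time.\<close>

lemma (in prob_space) bounded_convergence:
  fixes f :: "nat \<Rightarrow> 'a \<Rightarrow> 'b::{banach, second_countable_topology}"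
  assumes "\<And>n. f n \<in> borel_measurable M" "g \<in> borel_measurable M"
    and "\<And>n t. norm (f n t) \<le> B" "\<And>t. (\<lambda>n. f n t) \<longlonglongrightarrow> g t"
  shows "(\<lambda>n. integral\<^sup>L M (f n)) \<longlonglongrightarrow> integral\<^sup>L M g"
  by (rule integral_dominated_convergence[where w = "\<lambda>_. B"]) (use assms in auto)

lemma (in real_distribution) prob_UNIV [simp]: "prob UNIV = 1"
  using prob_space by simp

lemma (in real_distribution) integrable_resolvent:
  assumes "AE t in M. d \<le> norm (z - complex_of_real t)" "0 < d"
  shows "integrable M (\<lambda>t. 1 / (z - complex_of_real t))"
proof (rule integrable_const_bound[where B = "1 / d"])
  show "AE t in M. norm (1 / (z - complex_of_real t)) \<le> 1 / d"
    using assms(1) by eventually_elim (use \<open>0 < d\<close> in \<open>auto simp: norm_divide intro!: divide_left_mono mult_pos_pos\<close>)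
qed measurable

lemma Im_le_norm_resolvent: "\<bar>Im z\<bar> \<le> norm (z - complex_of_real t)"
  using abs_Im_le_cmod[of "z - complex_of_real t"] by simp

lemma (in real_distribution) integrable_resolvent_upper:
  "Im z > 0 \<Longrightarrow> integrable M (\<lambda>t. 1 / (z - complex_of_real t))"
  using Im_le_norm_resolvent[of z] by (intro integrable_resolvent[where d = "Im z"]) auto

text \<open>Under the integral the error of the difference quotient is
  \<open>(w - z) / ((w - t) * (z - t)\<^sup>2)\<close>, at most \<open>norm (w - z) / r ^ 3\<close>
  once the support stays at distance \<open>r\<close>. The closed set \<open>S\<close> lets one
  statement serve the slit plane and, for \<open>S = UNIV\<close>, the upper half-plane.\<close>

lemma (in real_distribution) holomorphic_cauchy_transform:
  assumes "closed S" "AE t in M. t \<in> S"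
  shows "cauchy_transform M holomorphic_on - (complex_of_real ` S)"
proof -
  let ?D = "- (complex_of_real ` S)"
  have "closed (complex_of_real ` S)"
    using \<open>closed S\<close> by (intro closed_injective_linear_image)
      (auto intro!: linear_of_real bounded_linear.linear bounded_linear_of_real injI)
  then have op: "open ?D" by auto
  have "\<exists>G'. (cauchy_transform M has_field_derivative G') (at z)" if z: "z \<in> ?D" for z
  proof -
    obtain e where e: "0 < e" "ball z e \<subseteq> ?D" using op z openE by blast
    \<comment> \<open>Half the radius, so that every point of \<open>ball z r\<close>, not only
      \<open>z\<close>, has distance at least \<open>r\<close> from the support.\<close>
    define r where "r = e / 2"
    have r: "0 < r" "ball z (2 * r) \<subseteq> ?D" using e by (auto simp: r_def)
    have far: "r \<le> norm (w - complex_of_real t)" if "t \<in> S" "w \<in> ball z r" for t w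
    proof (rule ccontr)
      assume "\<not> ?thesis"
      then have "dist z (complex_of_real t) < 2 * r"
        using that dist_triangle[of z "complex_of_real t" w] by (auto simp: dist_norm)
      then show False using r \<open>t \<in> S\<close> by auto
    qed
    have farAE: "AE t in M. r \<le> norm (w - complex_of_real t)" if "w \<in> ball z r" for w
      using assms(2) by eventually_elim (use far that in auto)
    have int: "integrable M (\<lambda>t. 1 / (w - complex_of_real t))" if "w \<in> ball z r" for w
      by (rule integrable_resolvent[OF farAE[OF that]]) (use r in auto)
    have int2: "integrable M (\<lambda>t. 1 / (z - complex_of_real t)\<^sup>2)"
    proof (rule integrable_const_bound[where B = "1 / r\<^sup>2"])
      show "AE t in M. norm (1 / (z - complex_of_real t)\<^sup>2) \<le> 1 / r\<^sup>2"
        using farAE[of z, simplified, OF r(1)]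
      proof eventually_elim
        case (elim t)
        then have "r\<^sup>2 \<le> (norm (z - complex_of_real t))\<^sup>2" using r by (intro power_mono) auto
        then show ?case using r unfolding norm_divide norm_power norm_one
          by (intro divide_left_mono mult_pos_pos) (auto intro: less_le_trans[OF zero_less_power])
      qed
    qed measurable
    define G' where "G' = - (LINT t|M. 1 / (z - complex_of_real t)\<^sup>2)"
    have bound: "norm ((cauchy_transform M w - cauchy_transform M z) / (w - z) - G') \<le> norm (w - z) / r ^ 3"
      if w: "w \<in> ball z r" "w \<noteq> z" for w
    proof -
      have "AE t in M. (1 / (w - complex_of_real t) - 1 / (z - complex_of_real t)) / (w - z) + 1 / (z - complex_of_real t)\<^sup>2
          = (w - z) / ((w - complex_of_real t) * (z - complex_of_real t)\<^sup>2) \<and>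
          norm ((w - z) / ((w - complex_of_real t) * (z - complex_of_real t)\<^sup>2)) \<le> norm (w - z) / r ^ 3"
        using farAE[OF w(1)] farAE[of z, simplified, OF r(1)]
      proof eventually_elim
        case (elim t)
        define p q where "p = w - complex_of_real t" and "q = z - complex_of_real t"
        have pq: "r \<le> norm p" "r \<le> norm q" "p \<noteq> 0" "q \<noteq> 0" "w - z = p - q" "p \<noteq> q"
          using elim r w by (auto simp: p_def q_def)
        have "r ^ 3 \<le> norm p * norm q ^ 2"
          unfolding power3_eq_cube power2_eq_square mult.assoc using pq r by (intro mult_mono) auto
        then have "norm (p - q) / (norm p * (norm q)\<^sup>2) \<le> norm (p - q) / r ^ 3"
          using pq r by (intro divide_left_mono) auto
        moreover have "(1 / p - 1 / q) / (p - q) + 1 / q\<^sup>2 = (p - q) / (p * q\<^sup>2)"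
        proof -
          have nz: "p - q \<noteq> 0" using pq by simp
          have "1 / p - 1 / q = - (1 / (p * q)) * (p - q)" using pq(3,4) by (simp add: field_simps)
          then have "(1 / p - 1 / q) / (p - q) = - (1 / (p * q))"
            unfolding nonzero_divide_eq_eq[OF nz] .
          moreover have "- (1 / (p * q)) + 1 / q\<^sup>2 = (p - q) / (p * q\<^sup>2)"
            using pq(3,4) by (simp add: field_simps power2_eq_square)
          ultimately show ?thesis by simp
        qed
        ultimately show ?case unfolding p_def[symmetric] q_def[symmetric] pq(5)
          by (simp add: norm_divide norm_mult norm_power)
      qed
      then have ae: "AE t in M. (1 / (w - complex_of_real t) - 1 / (z - complex_of_real t)) / (w - z) + 1 / (z - complex_of_real t)\<^sup>2
          = (w - z) / ((w - complex_of_real t) * (z - complex_of_real t)\<^sup>2)"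
        "AE t in M. norm ((w - z) / ((w - complex_of_real t) * (z - complex_of_real t)\<^sup>2)) \<le> norm (w - z) / r ^ 3"
        by (auto elim: eventually_mono)
      have zb: "z \<in> ball z r" using r by simp
      have "(cauchy_transform M w - cauchy_transform M z) / (w - z) - G' =
          (LINT t|M. (1 / (w - complex_of_real t) - 1 / (z - complex_of_real t)) / (w - z) + 1 / (z - complex_of_real t)\<^sup>2)"
        unfolding G'_def cauchy_transform_def using int[OF w(1)] int[OF zb] int2 by simp
      also have "\<dots> = (LINT t|M. (w - z) / ((w - complex_of_real t) * (z - complex_of_real t)\<^sup>2))"
        using ae(1) by (intro integral_cong_AE) auto
      also have "norm \<dots> \<le> (LINT t|M. norm (w - z) / r ^ 3)"
      proof (rule order.trans[OF integral_norm_bound], rule integral_mono_AE)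
        show "integrable M (\<lambda>t. norm ((w - z) / ((w - complex_of_real t) * (z - complex_of_real t)\<^sup>2)))"
          using ae(2) by (intro integrable_norm integrable_const_bound[where B = "norm (w - z) / r ^ 3"]) auto
      qed (use ae(2) in auto)
      finally show ?thesis by simp
    qed
    have "((\<lambda>w. (cauchy_transform M w - cauchy_transform M z) / (w - z)) \<longlongrightarrow> G') (at z)"
    proof (rule Lim_null_comparison[THEN LIM_zero_cancel])
      show "eventually (\<lambda>w. norm ((cauchy_transform M w - cauchy_transform M z) / (w - z) - G') \<le> norm (w - z) / r ^ 3) (at z)"
        using bound r(1) by (auto simp: eventually_at dist_commute intro!: exI[of _ r])
      show "((\<lambda>w. norm (w - z) / r ^ 3) \<longlongrightarrow> 0) (at z)"
        using r(1) by (auto intro!: tendsto_eq_intros)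
    qed
    then show ?thesis by (auto simp: has_field_derivative_iff)
  qed
  then show ?thesis
    unfolding holomorphic_on_def field_differentiable_def using has_field_derivative_at_within by blast
qed

section \<open>Stieltjes inversion\<close>

lemma (in real_distribution) Im_cauchy_transform:
  assumes "y > 0"
  shows "- Im (cauchy_transform M (Complex x y)) = (LINT t|M. y / ((x - t)\<^sup>2 + y\<^sup>2))"
proof -
  have "Im (cauchy_transform M (Complex x y)) = (LINT t|M. Im (1 / (Complex x y - complex_of_real t)))"
    unfolding cauchy_transform_def using integrable_resolvent_upper[of "Complex x y"] assms
    by (subst integral_Im) auto
  also have "\<dots> = (LINT t|M. - (y / ((x - t)\<^sup>2 + y\<^sup>2)))"
    by (intro Bochner_Integration.integral_cong) (simp_all add: Im_divide power2_eq_square)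
  finally show ?thesis by simp
qed

lemma abs_arctan_le: "\<bar>arctan u\<bar> \<le> pi / 2"
  using arctan_bounded[of u] by auto

lemma abs_arctan_diff_le: "\<bar>arctan u - arctan v\<bar> \<le> \<bar>u - v\<bar>"
proof -
  have "norm (arctan u - arctan v) \<le> 1 * norm (u - v)"
  proof (rule field_differentiable_bound[of UNIV])
    show "(arctan has_field_derivative inverse (1 + x\<^sup>2)) (at x within UNIV)" for x
      by (rule DERIV_subset[OF DERIV_arctan]) simp
    show "norm (inverse (1 + x\<^sup>2)) \<le> 1" for x :: real
      by (simp add: inverse_le_1_iff add_pos_nonneg)
  qed auto
  then show ?thesis by simp
qed

text \<open>At height \<open>y\<close> the imaginary part integrates the Poisson kernel, whose
  primitive in \<open>x\<close> is this arctangent. It is bounded and Lipschitz with constant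
  \<open>1 / y\<close>, so it may be differentiated under the integral, and the inversion runs
  without integrating over \<open>x\<close>.\<close>

lemma (in real_distribution) has_derivative_arctan_integral:
  assumes "y > 0"
  shows "((\<lambda>x. LINT t|M. arctan ((x - t) / y)) has_field_derivative - Im (cauchy_transform M (Complex x y))) (at x)"
  unfolding has_field_derivative_iff Im_cauchy_transform[OF assms]
proof (subst tendsto_at_iff_sequentially, intro allI impI)
  fix X :: "nat \<Rightarrow> real"
  assume X: "\<forall>i. X i \<in> UNIV - {x}" "X \<longlonglongrightarrow> x"
  have int: "integrable M (\<lambda>t. arctan ((c - t) / y))" for c
    by (rule integrable_const_bound[where B = "pi / 2"]) (use abs_arctan_le in simp_all)
  have deriv: "((\<lambda>x. arctan ((x - t) / y)) has_field_derivative (y / ((x - t)\<^sup>2 + y\<^sup>2))) (at x)" for t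
  proof -
    have "((\<lambda>x. (x - t) / y) has_field_derivative 1 / y) (at x)"
      using assms by (auto intro!: derivative_eq_intros)
    from DERIV_chain2[OF DERIV_arctan this]
    have "((\<lambda>x. arctan ((x - t) / y)) has_field_derivative inverse (1 + ((x - t) / y)\<^sup>2) * (1 / y)) (at x)" .
    moreover have "inverse (1 + ((x - t) / y)\<^sup>2) * (1 / y) = y / ((x - t)\<^sup>2 + y\<^sup>2)"
    proof -
      have "1 + ((x - t) / y)\<^sup>2 = ((x - t)\<^sup>2 + y\<^sup>2) / y\<^sup>2"
        using assms by (simp add: power_divide field_simps)
      then show ?thesis using assms by (simp add: power2_eq_square)
    qed
    ultimately show ?thesis by simp
  qed
  have "(\<lambda>n. LINT t|M. (arctan ((X n - t) / y) - arctan ((x - t) / y)) / (X n - x)) \<longlonglongrightarrow>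
      (LINT t|M. y / ((x - t)\<^sup>2 + y\<^sup>2))"
  proof (rule bounded_convergence[where B = "1 / y"])
    show "norm ((arctan ((X n - t) / y) - arctan ((x - t) / y)) / (X n - x)) \<le> 1 / y" for n t
    proof -
      have "\<bar>arctan ((X n - t) / y) - arctan ((x - t) / y)\<bar> \<le> \<bar>(X n - t) / y - (x - t) / y\<bar>"
        by (rule abs_arctan_diff_le)
      also have "\<dots> = \<bar>X n - x\<bar> / y" using assms by (simp add: diff_divide_distrib[symmetric])
      finally show ?thesis using X(1)[rule_format, of n] assms by (simp add: field_simps)
    qed
    show "(\<lambda>n. (arctan ((X n - t) / y) - arctan ((x - t) / y)) / (X n - x)) \<longlonglongrightarrow> y / ((x - t)\<^sup>2 + y\<^sup>2)" for t
      using deriv[of t] X unfolding has_field_derivative_iff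
      by (subst (asm) tendsto_at_iff_sequentially) (auto simp: comp_def)
  qed measurable
  then show "((\<lambda>w. ((LINT t|M. arctan ((w - t) / y)) - (LINT t|M. arctan ((x - t) / y))) / (w - x)) \<circ> X) \<longlonglongrightarrow>
      (LINT t|M. y / ((x - t)\<^sup>2 + y\<^sup>2))"
    using int by (simp add: comp_def)
qed

lemma (in real_distribution) tendsto_arctan_integral_at_bot:
  assumes "y > 0"
  shows "(\<lambda>n. LINT t|M. arctan ((- real n - t) / y)) \<longlonglongrightarrow> - (pi / 2)"
proof -
  have "(\<lambda>n. LINT t|M. arctan ((- real n - t) / y)) \<longlonglongrightarrow> (LINT t|M. - (pi / 2))"
  proof (rule bounded_convergence[where B = "pi / 2"])
    show "norm (arctan u) \<le> pi / 2" for u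
      using abs_arctan_le[of u] by simp
    show "(\<lambda>n. arctan ((- real n - t) / y)) \<longlonglongrightarrow> - (pi / 2)" for t
      by (rule filterlim_compose[OF tendsto_arctan_at_bot]) (use assms in real_asymp)
  qed measurable
  then show ?thesis by simp
qed

lemma (in real_distribution) tendsto_sgn_integral:
  "(\<lambda>n. LINT t|M. arctan ((b - t) / (1 / real (Suc n)))) \<longlonglongrightarrow> pi / 2 * (LINT t|M. sgn (b - t))"
proof -
  have "(\<lambda>n. LINT t|M. arctan ((b - t) / (1 / real (Suc n)))) \<longlonglongrightarrow> (LINT t|M. pi / 2 * sgn (b - t))"
  proof (rule bounded_convergence[where B = "pi / 2"])
    show "norm (arctan u) \<le> pi / 2" for u
      using abs_arctan_le[of u] by simp
    show "(\<lambda>n. arctan ((b - t) / (1 / real (Suc n)))) \<longlonglongrightarrow> pi / 2 * sgn (b - t)" for t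
    proof -
      consider "b = t" | "b > t" | "b < t" by linarith
      then show ?thesis
      proof cases
        case 2
        then have "filterlim (\<lambda>n. (b - t) / (1 / real (Suc n))) at_top sequentially" by real_asymp
        then show ?thesis using 2 by (auto intro: filterlim_compose[OF tendsto_arctan_at_top])
      next
        case 3
        then have "filterlim (\<lambda>n. (b - t) / (1 / real (Suc n))) at_bot sequentially" by real_asymp
        from filterlim_compose[OF tendsto_arctan_at_bot this] show ?thesis using 3 by simp
      qed auto
    qed
  qed measurable
  then show ?thesis by simp
qed

text \<open>The sign at \<open>b\<close> itself would count an atom there by half. Approaching
  \<open>b\<close> strictly from the right counts all of it, as the distribution function
  does.\<close>

lemma (in real_distribution) tendsto_sgn_integral_cdf:
  "(\<lambda>n. LINT t|M. sgn (b + 1 / real (Suc n) - t)) \<longlonglongrightarrow> 2 * cdf M b - 1"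
proof -
  have "(\<lambda>n. LINT t|M. sgn (b + 1 / real (Suc n) - t)) \<longlonglongrightarrow> (LINT t|M. 2 * indicator {..b} t - 1)"
  proof (rule bounded_convergence[where B = 1])
    show "norm (sgn u) \<le> 1" for u :: real by (simp add: sgn_if)
    show "(\<lambda>n. sgn (b + 1 / real (Suc n) - t)) \<longlonglongrightarrow> 2 * indicator {..b} t - 1" for t
    proof (cases "t \<le> b")
      case True
      then have "sgn (b + 1 / real (Suc n) - t) = 1" for n
      proof -
        have "0 < 1 / real (Suc n)" by simp
        with True have "b + 1 / real (Suc n) - t > 0" by linarith
        then show ?thesis by simp
      qed
      then show ?thesis using True by simp
    next
      case False
      then have "(\<lambda>n. b + 1 / real (Suc n) - t) \<longlonglongrightarrow> b - t" by real_asymp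
      then have "eventually (\<lambda>n. b + 1 / real (Suc n) - t < 0) sequentially"
        using False by (intro order_tendstoD(2)) auto
      then have "eventually (\<lambda>n. sgn (b + 1 / real (Suc n) - t) = -1) sequentially"
        by eventually_elim simp
      then show ?thesis using False by (auto intro: tendsto_eventually)
    qed
  qed measurable
  also have "(LINT t|M. 2 * indicator {..b} t - 1) = 2 * cdf M b - 1"
    by (simp add: cdf_def integrable_real_indicator emeasure_eq_measure)
  finally show ?thesis .
qed

text \<open>The arctangent integrals of both measures have the same derivative in \<open>x\<close>
  and the same limit at minus infinity, hence agree at every height \<open>y\<close>. Letting
  \<open>y\<close> tend to 0 gives the sign integrals, and these give the distribution
  functions.\<close>

theorem cauchy_transform_unique:
  assumes "real_distribution \<mu>" "real_distribution \<nu>"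
    and eq: "\<And>z. Im z > 0 \<Longrightarrow> cauchy_transform \<mu> z = cauchy_transform \<nu> z"
  shows "\<mu> = \<nu>"
proof (rule cdf_unique[OF assms(1,2)], rule ext)
  fix b
  interpret \<mu>: real_distribution \<mu> by fact
  interpret \<nu>: real_distribution \<nu> by fact
  have arc: "(LINT t|\<mu>. arctan ((x - t) / y)) = (LINT t|\<nu>. arctan ((x - t) / y))" if y: "y > 0" for x y
  proof -
    define h where "h x = (LINT t|\<mu>. arctan ((x - t) / y)) - (LINT t|\<nu>. arctan ((x - t) / y))" for x
    have "(h has_field_derivative 0) (at x)" for x
      unfolding h_def using DERIV_diff[OF \<mu>.has_derivative_arctan_integral[OF y] \<nu>.has_derivative_arctan_integral[OF y], of x]
        eq[of "Complex x y"] y by simp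
    then have const: "h x = h x'" for x x'
      by (intro DERIV_isconst_all) auto
    have "(\<lambda>n. h (- real n)) \<longlonglongrightarrow> - (pi / 2) - - (pi / 2)"
      unfolding h_def by (intro tendsto_diff \<mu>.tendsto_arctan_integral_at_bot \<nu>.tendsto_arctan_integral_at_bot y)
    moreover have "(\<lambda>n. h (- real n)) = (\<lambda>n. h x)" using const by blast
    ultimately have "h x = 0" by (simp add: LIMSEQ_const_iff)
    then show ?thesis by (simp add: h_def)
  qed
  have sgn: "(LINT t|\<mu>. sgn (b - t)) = (LINT t|\<nu>. sgn (b - t))" for b
  proof -
    have "pi / 2 * (LINT t|\<mu>. sgn (b - t)) = pi / 2 * (LINT t|\<nu>. sgn (b - t))"
      by (rule LIMSEQ_unique[OF \<mu>.tendsto_sgn_integral[of b]])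
        (subst arc, simp, rule \<nu>.tendsto_sgn_integral)
    then show ?thesis by simp
  qed
  have "2 * cdf \<mu> b - 1 = 2 * cdf \<nu> b - 1"
    by (rule LIMSEQ_unique[OF \<mu>.tendsto_sgn_integral_cdf]) (subst sgn, rule \<nu>.tendsto_sgn_integral_cdf)
  then show "cdf \<mu> b = cdf \<nu> b" by simp
qed


section \<open>The transform \<open>\<Psi>\<close> of measures on the half-line\<close>

lemma nonneg_distributionD:
  assumes "nonneg_distribution \<mu>"
  shows "real_distribution \<mu>" "AE t in \<mu>. 0 \<le> t"
  using assms by (auto simp: nonneg_distribution_def)

lemma one_minus_mult_ge_1: "1 \<le> 1 - t * z" if "0 \<le> t" "z < 0" for t z :: real
  using mult_nonneg_nonpos[of t z] that by simp

lemma
  fixes t z :: real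
  assumes "0 \<le> t" "z < 0"
  shows kernel_pos: "0 < 1 / (1 - t * z)" and kernel_le_1: "1 / (1 - t * z) \<le> 1"
    and kernel_less_1: "0 < t \<Longrightarrow> 1 / (1 - t * z) < 1"
    and kernel_eq: "t * z / (1 - t * z) = 1 / (1 - t * z) - 1"
proof -
  have "1 \<le> 1 - t * z" using assms by (rule one_minus_mult_ge_1)
  then show "0 < 1 / (1 - t * z)" "1 / (1 - t * z) \<le> 1" "t * z / (1 - t * z) = 1 / (1 - t * z) - 1"
    by (simp_all add: field_simps)
  show "1 / (1 - t * z) < 1" if "0 < t"
    using mult_pos_neg[OF that \<open>z < 0\<close>] by simp
qed

lemma
  assumes \<mu>: "nonneg_distribution \<mu>" and z: "z < 0"
  shows integrable_Psi: "integrable \<mu> (\<lambda>t. 1 / (1 - t * z))"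
    and one_plus_Psi: "1 + Psi_transform \<mu> z = (LINT t|\<mu>. 1 / (1 - t * z))"
proof -
  interpret real_distribution \<mu> using nonneg_distributionD[OF \<mu>] by simp
  show int: "integrable \<mu> (\<lambda>t. 1 / (1 - t * z))"
  proof (rule integrable_const_bound[where B = 1])
    show "AE t in \<mu>. norm (1 / (1 - t * z)) \<le> 1"
      using nonneg_distributionD(2)[OF \<mu>]
      by eventually_elim (use kernel_pos kernel_le_1 z in \<open>simp add: less_imp_le\<close>)
  qed measurable
  have "Psi_transform \<mu> z = (LINT t|\<mu>. 1 / (1 - t * z) - 1)"
    unfolding Psi_transform_def set_lebesgue_integral_def
  proof (rule integral_cong_AE)
    show "AE t in \<mu>. indicat_real {0..} t *\<^sub>R (t * z / (1 - t * z)) = 1 / (1 - t * z) - 1"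
      using nonneg_distributionD(2)[OF \<mu>]
      by eventually_elim (use kernel_eq z in simp)
  qed measurable
  also have "\<dots> = (LINT t|\<mu>. 1 / (1 - t * z)) - 1"
    using int by simp
  finally show "1 + Psi_transform \<mu> z = (LINT t|\<mu>. 1 / (1 - t * z))" by simp
qed

lemma cauchy_transform_negative:
  assumes \<mu>: "nonneg_distribution \<mu>" and w: "w < 0"
  shows "cauchy_transform \<mu> (of_real w) = of_real ((1 + Psi_transform \<mu> (1 / w)) / w)"
proof -
  have eq: "1 / (of_real w - complex_of_real t) = complex_of_real (1 / w * (1 / (1 - t * (1 / w))))" for t
    using w by (cases "w = t") (auto simp: field_simps simp flip: of_real_diff)
  show ?thesis
    unfolding cauchy_transform_def eq integral_complex_of_real integral_mult_right_zero
    using one_plus_Psi[OF \<mu>, of "1 / w"] w by simp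
qed

text \<open>On the negative axis the Cauchy transform is a function of \<open>\<Psi>\<close>. That
  axis accumulates at -1 inside the connected plane slit along the nonnegative reals, so the
  identity theorem carries the equality to the upper half-plane.\<close>

lemma Psi_transform_unique:
  assumes \<mu>: "nonneg_distribution \<mu>" and \<nu>: "nonneg_distribution \<nu>"
    and eq: "\<And>z. z < 0 \<Longrightarrow> Psi_transform \<mu> z = Psi_transform \<nu> z"
  shows "\<mu> = \<nu>"
proof (rule cauchy_transform_unique)
  show dist: "real_distribution \<mu>" "real_distribution \<nu>"
    using \<mu> \<nu> by (simp_all add: nonneg_distribution_def)
  fix z :: complex assume z: "Im z > 0"
  let ?S = "- (complex_of_real ` {0..})" and ?f = "\<lambda>z. cauchy_transform \<mu> z - cauchy_transform \<nu> z"
  have hol: "cauchy_transform \<rho> holomorphic_on ?S" if "nonneg_distribution \<rho>" for \<rho>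
    using that by (intro real_distribution.holomorphic_cauchy_transform) (auto simp: nonneg_distribution_def)
  have "?f z = 0"
  proof (rule analytic_continuation[of ?f ?S "complex_of_real ` {..<0}" "complex_of_real (-1)" z])
    show "?f holomorphic_on ?S" using hol \<mu> \<nu> by (intro holomorphic_intros)
    have "closed (complex_of_real ` {0..})"
      by (intro closed_injective_linear_image)
        (auto intro!: linear_of_real bounded_linear.linear bounded_linear_of_real injI)
    then show "open ?S" by auto
    show "connected ?S"
      using starlike_slotted_complex_plane_right by (rule starlike_imp_connected)
    show "complex_of_real (-1) islimpt complex_of_real ` {..<0}"
      unfolding islimpt_approachable
    proof (intro allI impI)
      fix e :: real assume "0 < e"
      then show "\<exists>x'\<in>complex_of_real ` {..<0}. x' \<noteq> complex_of_real (- 1) \<and> dist x' (complex_of_real (- 1)) < e"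
        by (intro bexI[of _ "complex_of_real (-1 - e / 2)"])
          (auto simp: dist_norm norm_divide simp del: of_real_minus of_real_diff of_real_add simp flip: of_real_minus of_real_diff)
    qed
    have "complex_of_real (-1) \<noteq> complex_of_real x" if "0 \<le> x" for x
      using that unfolding of_real_eq_iff by simp
    then show "complex_of_real (-1) \<in> ?S" by blast
  qed (use z eq in \<open>auto simp: cauchy_transform_negative \<mu> \<nu>\<close>)
  then show "cauchy_transform \<mu> z = cauchy_transform \<nu> z" by simp
qed

lemma emeasure_positive_nonzero:
  assumes \<mu>: "nonneg_distribution \<mu>" and lt: "measure \<mu> {0} < 1"
  shows "emeasure \<mu> {0<..} \<noteq> 0"
proof
  interpret real_distribution \<mu> using nonneg_distributionD[OF \<mu>] by simp
  assume "emeasure \<mu> {0<..} = 0"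
  then have "AE t in \<mu>. t \<notin> {0<..}" by (intro AE_not_in) (auto simp: null_sets_def)
  with nonneg_distributionD(2)[OF \<mu>] have "AE t in \<mu>. t \<in> {0}" by eventually_elim auto
  then have "prob {0} = 1" by (intro prob_eq_1[THEN iffD2]) auto
  with lt show False by simp
qed

text \<open>The kernel lies between the indicator of {0} and 1, strictly so at positive
  \<open>t\<close>. If not all mass sits at 0, the positive half-line is not null and both strict
  inequalities survive integration.\<close>

lemma
  assumes \<mu>: "nonneg_distribution \<mu>" and z: "z < 0"
  shows one_plus_Psi_ge: "measure \<mu> {0} \<le> 1 + Psi_transform \<mu> z"
    and Psi_nonpos: "Psi_transform \<mu> z \<le> 0"
    and Psi_in_S_domain: "measure \<mu> {0} < 1 \<Longrightarrow> Psi_transform \<mu> z \<in> S_domain \<mu>"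
proof -
  interpret real_distribution \<mu> using nonneg_distributionD[OF \<mu>] by simp
  note nn = nonneg_distributionD(2)[OF \<mu>] and int = integrable_Psi[OF \<mu> z]
  have int0: "integrable \<mu> (indicat_real {0})"
    by (intro integrable_real_indicator) (auto simp: emeasure_eq_measure)
  have le0: "AE t in \<mu>. indicat_real {0} t \<le> 1 / (1 - t * z)"
    using nn by eventually_elim (use kernel_pos z in \<open>simp add: indicator_def less_imp_le\<close>)
  have le1: "AE t in \<mu>. 1 / (1 - t * z) \<le> 1"
    using nn by eventually_elim (use kernel_le_1 z in simp)
  have m0: "(LINT t|\<mu>. indicat_real {0} t) = measure \<mu> {0}" by simp
  show "measure \<mu> {0} \<le> 1 + Psi_transform \<mu> z"
    unfolding one_plus_Psi[OF \<mu> z] m0[symmetric] using int int0 le0 by (intro integral_mono_AE)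
  have "(LINT t|\<mu>. 1 / (1 - t * z)) \<le> (LINT t|\<mu>. 1)"
    using int le1 by (intro integral_mono_AE) auto
  then show "Psi_transform \<mu> z \<le> 0"
    using one_plus_Psi[OF \<mu> z] by simp
  assume lt: "measure \<mu> {0} < 1"
  note pos = emeasure_positive_nonzero[OF \<mu> lt]
  have "(LINT t|\<mu>. indicat_real {0} t) < (LINT t|\<mu>. 1 / (1 - t * z))"
  proof (rule integral_less_AE[OF int0 int pos])
    show "AE t in \<mu>. t \<in> {0<..} \<longrightarrow> indicat_real {0} t \<noteq> 1 / (1 - t * z)"
      using nn by eventually_elim (use kernel_pos[OF _ z] in \<open>simp add: indicator_def less_imp_neq\<close>)
  qed (use le0 in auto)
  moreover have "(LINT t|\<mu>. 1 / (1 - t * z)) < (LINT t|\<mu>. 1)"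
  proof (rule integral_less_AE[OF int _ pos])
    show "AE t in \<mu>. t \<in> {0<..} \<longrightarrow> 1 / (1 - t * z) \<noteq> 1"
      using nn by eventually_elim (metis kernel_less_1 z less_irrefl greaterThan_iff)
  qed (use le1 in auto)
  ultimately show "Psi_transform \<mu> z \<in> S_domain \<mu>"
    using one_plus_Psi[OF \<mu> z] by (simp add: S_domain_def)
qed

lemma inj_on_Psi_transform:
  assumes \<mu>: "nonneg_distribution \<mu>" and lt: "measure \<mu> {0} < 1"
  shows "inj_on (Psi_transform \<mu>) {..<0}"
proof -
  interpret real_distribution \<mu> using nonneg_distributionD[OF \<mu>] by simp
  note nn = nonneg_distributionD(2)[OF \<mu>]
  note pos = emeasure_positive_nonzero[OF \<mu> lt]
  have "Psi_transform \<mu> z < Psi_transform \<mu> z'" if zz: "z < z'" "z' < 0" for z z'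
  proof -
    have z: "z < 0" using zz by simp
    have less: "1 / (1 - t * z) < 1 / (1 - t * z')" if "0 < t" for t
      using one_minus_mult_ge_1[of t z] one_minus_mult_ge_1[of t z'] that zz z
      by (intro divide_strict_left_mono) auto
    have le: "1 / (1 - t * z) \<le> 1 / (1 - t * z')" if "0 \<le> t" for t
      using less[of t] that by (cases "t = 0") auto
    have "(LINT t|\<mu>. 1 / (1 - t * z)) < (LINT t|\<mu>. 1 / (1 - t * z'))"
    proof (rule integral_less_AE[OF integrable_Psi[OF \<mu> z] integrable_Psi[OF \<mu> zz(2)] pos])
      show "AE t in \<mu>. t \<in> {0<..} \<longrightarrow> 1 / (1 - t * z) \<noteq> 1 / (1 - t * z')"
        using less less_imp_neq by (intro AE_I2 impI) auto
      show "AE t in \<mu>. 1 / (1 - t * z) \<le> 1 / (1 - t * z')"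
        using nn by eventually_elim (rule le)
    qed simp
    then show ?thesis using one_plus_Psi[OF \<mu> z] one_plus_Psi[OF \<mu> zz(2)] by simp
  qed
  then show ?thesis
    by (intro linorder_inj_onI) (auto dest: less_imp_neq)
qed

section \<open>Tightness and weak limits on the half-line\<close>

lemma tail_le_Psi:
  assumes \<mu>: "nonneg_distribution \<mu>" and M: "M > 0"
  shows "measure \<mu> {M<..} \<le> - 2 * Psi_transform \<mu> (- 1 / M)"
proof -
  interpret real_distribution \<mu> using nonneg_distributionD[OF \<mu>] by simp
  have z: "- 1 / M < 0" using M by simp
  \<comment> \<open>Markov's inequality: beyond \<open>M\<close> the function
    \<open>1 - 1 / (1 + t / M)\<close> exceeds 1/2, whence the factor 2.\<close>
  have "(LINT t|\<mu>. indicat_real {M<..} t) \<le> (LINT t|\<mu>. 2 * (1 - 1 / (1 - t * (- 1 / M))))"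
  proof (rule integral_mono_AE)
    show "integrable \<mu> (indicat_real {M<..})"
      by (intro integrable_real_indicator) (auto simp: emeasure_eq_measure)
    show "AE t in \<mu>. indicat_real {M<..} t \<le> 2 * (1 - 1 / (1 - t * (- 1 / M)))"
      using nonneg_distributionD(2)[OF \<mu>]
    proof eventually_elim
      case (elim t)
      have "1 - t * (- 1 / M) = 1 + t / M" by simp
      moreover have "2 * (1 - 1 / (1 + x)) \<ge> 0" "x > 1 \<Longrightarrow> 2 * (1 - 1 / (1 + x)) \<ge> 1" if "x \<ge> 0" for x :: real
        using that by (simp_all add: field_simps)
      moreover have "t / M \<ge> 0" "M < t \<longrightarrow> t / M > 1" using elim M by auto
      ultimately show ?case by (cases "M < t") (simp_all only: indicator_def greaterThan_iff if_True if_False of_bool_eq)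
    qed
    show "integrable \<mu> (\<lambda>t. 2 * (1 - 1 / (1 - t * (- 1 / M))))"
      by (intro integrable_mult_right Bochner_Integration.integrable_diff integrable_Psi[OF \<mu> z] integrable_const)
  qed
  also have "\<dots> = 2 * (1 - (1 + Psi_transform \<mu> (- 1 / M)))"
    unfolding one_plus_Psi[OF \<mu> z] integral_mult_right_zero
    by (subst Bochner_Integration.integral_diff) (use integrable_Psi[OF \<mu> z] in simp_all)
  finally show ?thesis by simp
qed

lemma weak_conv_nonneg_distribution:
  assumes \<mu>: "\<And>n. nonneg_distribution (\<mu> n)" and \<nu>: "real_distribution \<nu>" and conv: "weak_conv_m \<mu> \<nu>"
  shows "nonneg_distribution \<nu>"
proof -
  interpret \<nu>: real_distribution \<nu> by fact
  interpret \<mu>: real_distribution "\<mu> n" for n using nonneg_distributionD[OF \<mu>] by simp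
  have zero: "measure \<nu> {..x} = 0" if "x < 0" for x
  proof -
    \<comment> \<open>Weak convergence speaks only about continuity points of the limit; a monotone
      function has at most countably many others, so a usable point lies between \<open>x\<close>
      and 0.\<close>
    have "\<exists>y\<in>{x<..<0}. isCont (cdf \<nu>) y"
    proof (rule ccontr)
      assume "\<not> ?thesis"
      then have "{x<..<0} \<subseteq> {y. \<not> isCont (cdf \<nu>) y}" by auto
      moreover have "countable {y. \<not> isCont (cdf \<nu>) y}"
        using \<nu>.cdf_nondecreasing by (intro mono_ctble_discont monoI)
      ultimately have "countable {x<..<0}" by (rule countable_subset)
      then show False using that uncountable_open_interval by blast
    qed
    then obtain y where y: "x < y" "y < 0" "isCont (cdf \<nu>) y" by auto
    have "cdf (\<mu> n) y = 0" for n
    proof -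
      have "AE t in \<mu> n. t \<notin> {..y}"
        using nonneg_distributionD(2)[OF \<mu>[of n]] by eventually_elim (use y in auto)
      then show ?thesis using \<mu>.prob_eq_0[of "{..y}" n] by (simp add: cdf_def)
    qed
    then have "(\<lambda>n. 0) \<longlonglongrightarrow> cdf \<nu> y"
      using conv y by (auto simp: weak_conv_m_def weak_conv_def)
    then have "cdf \<nu> y = 0" by (simp add: LIMSEQ_const_iff)
    then have "measure \<nu> {..x} \<le> 0"
      using \<nu>.finite_measure_mono[of "{..x}" "{..y}"] y by (auto simp: cdf_def)
    then show ?thesis by (simp add: measure_le_0_iff)
  qed
  have "AE t in \<nu>. t \<notin> {..- 1 / real (Suc n)}" for n
    using zero[of "- 1 / real (Suc n)"] \<nu>.prob_eq_0[of "{..- 1 / real (Suc n)}"] by simp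
  then have "AE t in \<nu>. \<forall>n. t \<notin> {..- 1 / real (Suc n)}"
    by (simp add: AE_all_countable)
  then have "AE t in \<nu>. 0 \<le> t"
  proof eventually_elim
    case (elim t)
    show ?case
    proof (rule ccontr)
      assume "\<not> 0 \<le> t"
      then obtain n where "inverse (real (Suc n)) < - t" using reals_Archimedean[of "- t"] by auto
      with elim[rule_format, of n] show False by (auto simp: inverse_eq_divide)
    qed
  qed
  with \<nu> show ?thesis by (simp add: nonneg_distribution_def)
qed

lemma weak_conv_Psi_transform:
  assumes \<mu>: "\<And>n. nonneg_distribution (\<mu> n)" and \<nu>: "nonneg_distribution \<nu>" and conv: "weak_conv_m \<mu> \<nu>"
    and z: "z < 0"
  shows "(\<lambda>n. Psi_transform (\<mu> n) z) \<longlonglongrightarrow> Psi_transform \<nu> z"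
proof -
  \<comment> \<open>In \<open>t\<close> the kernel has a pole at \<open>1 / z < 0\<close>;
    \<open>max 0 t\<close> makes it bounded and continuous on the whole line and changes it only on
    a null set.\<close>
  let ?f = "\<lambda>t::real. 1 / (1 - max 0 t * z)"
  have ge: "1 \<le> 1 - max 0 t * z" for t using one_minus_mult_ge_1[of "max 0 t" z] z by simp
  have eq: "(LINT t|\<rho>. ?f t) = 1 + Psi_transform \<rho> z" if "nonneg_distribution \<rho>" for \<rho>
  proof -
    interpret real_distribution \<rho> using that by (simp add: nonneg_distribution_def)
    show ?thesis unfolding one_plus_Psi[OF that z]
      using nonneg_distributionD(2)[OF that] by (intro integral_cong_AE) (auto elim!: eventually_mono simp: max_def)
  qed
  have "(\<lambda>n. integral\<^sup>L (\<mu> n) ?f) \<longlonglongrightarrow> integral\<^sup>L \<nu> ?f"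
  proof (rule weak_conv_imp_integral_bdd_continuous_conv)
    show "isCont ?f x" for x
      using ge[of x] by (intro continuous_intros) auto
    show "norm (?f x) \<le> 1" for x
      using ge[of x] by simp
  qed (use \<mu> \<nu> conv in \<open>auto simp: nonneg_distribution_def\<close>)
  then have "(\<lambda>n. 1 + Psi_transform (\<mu> n) z - 1) \<longlonglongrightarrow> 1 + Psi_transform \<nu> z - 1"
    unfolding eq[OF \<mu>] eq[OF \<nu>] by (intro tendsto_diff tendsto_const)
  then show ?thesis by simp
qed

text \<open>The tail bound at the threshold \<open>- 1 / z\<close> disposes of all large
  \<open>n\<close>; the finitely many others are tight one by one.\<close>

lemma tight_nonneg_distributions:
  assumes \<mu>: "\<And>n. nonneg_distribution (\<mu> n)"
    and small: "\<And>\<epsilon>. \<epsilon> > 0 \<Longrightarrow> \<exists>z<0. eventually (\<lambda>n. - \<epsilon> < Psi_transform (\<mu> n) z) sequentially"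
  shows "tight \<mu>"
  unfolding tight_def
proof (intro conjI allI impI)
  interpret \<mu>: real_distribution "\<mu> n" for n using nonneg_distributionD[OF \<mu>] by simp
  show "real_distribution (\<mu> n)" for n by (rule \<mu>.real_distribution_axioms)
  fix \<epsilon> :: real assume \<epsilon>: "\<epsilon> > 0"
  obtain z where z: "z < 0" "eventually (\<lambda>n. - (\<epsilon> / 2) < Psi_transform (\<mu> n) z) sequentially"
    using small[of "\<epsilon> / 2"] \<epsilon> by auto
  then obtain N where N: "\<And>n. n \<ge> N \<Longrightarrow> - (\<epsilon> / 2) < Psi_transform (\<mu> n) z"
    by (auto simp: eventually_sequentially)
  have "eventually (\<lambda>x. 1 - \<epsilon> < cdf (\<mu> n) x) at_top" for n
    using \<mu>.cdf_lim_at_top_prob[of n] \<epsilon> by (intro order_tendstoD(1)) auto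
  then have "eventually (\<lambda>x. (\<forall>n\<in>{..<N}. 1 - \<epsilon> < cdf (\<mu> n) x) \<and> x \<ge> - 1 / z \<and> x \<ge> 0) at_top"
    by (intro eventually_conj eventually_ball_finite eventually_ge_at_top) auto
  then obtain x where x: "\<And>n. n < N \<Longrightarrow> 1 - \<epsilon> < cdf (\<mu> n) x" "x \<ge> - 1 / z" "x \<ge> 0"
    by (auto simp: eventually_at_top_linorder)
  \<comment> \<open>Tightness is stated with intervals open on the left; the endpoint -1 keeps a
    possible atom at 0 inside.\<close>
  have neg: "measure (\<mu> n) {..-1} = 0" for n
  proof -
    have "AE t in \<mu> n. t \<notin> {..-1}"
      using nonneg_distributionD(2)[OF \<mu>[of n]] by eventually_elim auto
    then show ?thesis using \<mu>.prob_eq_0[of "{..-1}" n] by simp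
  qed
  have "1 - \<epsilon> < measure (\<mu> n) {-1<..x}" for n
  proof -
    have "1 - \<epsilon> < measure (\<mu> n) {..x}"
    proof (cases "n < N")
      case True then show ?thesis using x by (simp add: cdf_def)
    next
      case False
      have "measure (\<mu> n) {- 1 / z<..} \<le> - 2 * Psi_transform (\<mu> n) (- 1 / (- 1 / z))"
        using z by (intro tail_le_Psi \<mu>) (simp add: divide_neg_neg)
      moreover have "measure (\<mu> n) {x<..} \<le> measure (\<mu> n) {- 1 / z<..}"
        using x(2) by (intro \<mu>.finite_measure_mono) auto
      moreover have "measure (\<mu> n) {..x} = 1 - measure (\<mu> n) {x<..}"
        using \<mu>.prob_compl[of "{x<..}" n] by (simp add: Compl_eq_Diff_UNIV[symmetric] Compl_greaterThan)
      ultimately show ?thesis using N[of n] False z by simp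
    qed
    also have "{..x} = {..-1} \<union> {-1<..x}" using x(3) by auto
    also have "measure (\<mu> n) \<dots> = measure (\<mu> n) {..-1} + measure (\<mu> n) {-1<..x}"
      by (intro \<mu>.finite_measure_Union) auto
    finally show ?thesis using neg[of n] by simp
  qed
  then show "\<exists>a b. a < b \<and> (\<forall>n. 1 - \<epsilon> < measure (\<mu> n) {a<..b})"
    using x(3) by (intro exI[of _ "-1"] exI[of _ x]) auto
qed

text \<open>The counterpart of Levy's continuity theorem. The limit 0 of \<open>u\<close> at 0 from
  the left keeps mass from escaping to infinity; every subsequential limit then has transform
  \<open>u\<close>, and uniqueness makes them coincide.\<close>

theorem Psi_transform_continuity:
  assumes \<mu>: "\<And>n. nonneg_distribution (\<mu> n)"
    and lim: "\<And>z. z < 0 \<Longrightarrow> (\<lambda>n. Psi_transform (\<mu> n) z) \<longlonglongrightarrow> u z"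
    and u0: "(u \<longlongrightarrow> 0) (at_left 0)"
  shows "\<exists>\<nu>. nonneg_distribution \<nu> \<and> (\<forall>z<0. Psi_transform \<nu> z = u z) \<and> weak_conv_m \<mu> \<nu>"
proof -
  have dist: "real_distribution (\<mu> n)" for n using nonneg_distributionD[OF \<mu>] by simp
  have tight: "tight \<mu>"
  proof (rule tight_nonneg_distributions[OF \<mu>])
    fix \<epsilon> :: real assume "\<epsilon> > 0"
    then have "eventually (\<lambda>z. - \<epsilon> < u z) (at_left 0)"
      using u0 by (intro order_tendstoD(1)) auto
    then obtain b where b: "b < 0" "\<And>y. b < y \<Longrightarrow> y < 0 \<Longrightarrow> - \<epsilon> < u y"
      by (auto simp: eventually_at_left_field)
    then have "- \<epsilon> < u (b / 2)" by auto
    then show "\<exists>z<0. eventually (\<lambda>n. - \<epsilon> < Psi_transform (\<mu> n) z) sequentially"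
      using b(1) lim[of "b / 2"] by (intro exI[of _ "b / 2"] conjI order_tendstoD(1)) auto
  qed
  have sub: "nonneg_distribution \<rho> \<and> (\<forall>z<0. Psi_transform \<rho> z = u z)"
    if "strict_mono s" "real_distribution \<rho>" "weak_conv_m (\<mu> \<circ> s) \<rho>" for s \<rho>
  proof -
    have \<mu>s: "nonneg_distribution ((\<mu> \<circ> s) n)" for n using \<mu> by simp
    have \<rho>: "nonneg_distribution \<rho>" by (rule weak_conv_nonneg_distribution[OF \<mu>s that(2,3)])
    have "Psi_transform \<rho> z = u z" if "z < 0" for z
      using weak_conv_Psi_transform[OF \<mu>s \<rho> \<open>weak_conv_m (\<mu> \<circ> s) \<rho>\<close> that]
        LIMSEQ_subseq_LIMSEQ[OF lim[OF that] \<open>strict_mono s\<close>]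
      by (intro LIMSEQ_unique) (auto simp: comp_def)
    with \<rho> show ?thesis by blast
  qed
  obtain r \<nu> where r: "strict_mono (r :: nat \<Rightarrow> nat)" "real_distribution \<nu>" "weak_conv_m (\<mu> \<circ> id \<circ> r) \<nu>"
    using tight_imp_convergent_subsubsequence[OF tight, of id] by (auto simp: strict_mono_def)
  then have \<nu>: "nonneg_distribution \<nu>" "\<And>z. z < 0 \<Longrightarrow> Psi_transform \<nu> z = u z"
    using sub[of r \<nu>] by auto
  have "weak_conv_m \<mu> \<nu>"
  proof (rule tight_subseq_weak_converge[OF dist r(2) tight])
    fix s \<rho> assume s: "strict_mono s" "real_distribution \<rho>" "weak_conv_m (\<mu> \<circ> s) \<rho>"
    then have "\<rho> = \<nu>" using sub[OF s] \<nu> by (intro Psi_transform_unique) auto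
    with s show "weak_conv_m (\<mu> \<circ> s) \<nu>" by simp
  qed
  with \<nu> show ?thesis by blast
qed


section \<open>Rodrigues polynomials with positive roots\<close>

text \<open>The polynomial \<open>P\<^sub>j\<close> in \<open>D\<^sup>j (t\<^sup>A (1 + t)\<^bsup>-B\<^esup>) = t\<^bsup>A-j\<^esup> (1 + t)\<^bsup>-B-j\<^esup> P\<^sub>j(t)\<close>, where \<open>D = A - B\<close>
  in the parameters below.\<close>

definition rodrigues_coeff :: "real \<Rightarrow> real \<Rightarrow> nat \<Rightarrow> nat \<Rightarrow> real" where
  "rodrigues_coeff A D j k =
     real (j choose k) * pochhammer (A - real j + real k + 1) (j - k) * pochhammer (D + 1 - real j) k"

definition rodrigues_poly :: "real \<Rightarrow> real \<Rightarrow> nat \<Rightarrow> complex poly" where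
  "rodrigues_poly A D j = (\<Sum>k\<le>j. monom (complex_of_real (rodrigues_coeff A D j k)) k)"

lemma coeff_rodrigues_poly: "coeff (rodrigues_poly A D j) k = complex_of_real (rodrigues_coeff A D j k)"
  by (simp add: rodrigues_poly_def coeff_sum sum.delta' rodrigues_coeff_def binomial_eq_0)

text \<open>Once the common Pochhammer factors are taken out, what remains is
  \<open>(m + 1) * (j choose Suc m) = (j - m) * (j choose m)\<close>.\<close>

lemma rodrigues_coeff_Suc_Suc:
  "rodrigues_coeff A D (Suc j) (Suc m) =
     (real m + 1 + A - real j) * rodrigues_coeff A D j (Suc m) + (real m + D - 2 * real j) * rodrigues_coeff A D j m"
proof -
  define q where "q = pochhammer (D + 1 - real j) m"
  have D1: "pochhammer (D + 1 - real (Suc j)) (Suc m) = (D - real j) * q"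
    unfolding q_def by (simp add: pochhammer_rec algebra_simps)
  have D2: "pochhammer (D + 1 - real j) (Suc m) = q * (D + 1 - real j + real m)"
    unfolding q_def by (simp add: pochhammer_Suc)
  consider "m < j" | "m = j" | "m > j" by linarith
  then show ?thesis
  proof cases
    case 1
    then obtain i where i: "j - m = Suc i" by (metis Suc_diff_Suc)
    define p where "p = pochhammer (A - real j + real m + 2) i"
    have A1: "pochhammer (A - real j + real m + 1) (j - m) = (A - real j + real m + 1) * p"
      unfolding i p_def by (simp add: pochhammer_rec add.assoc)
    have A2: "pochhammer (A - real j + real (Suc m) + 1) (j - Suc m) = p"
    proof -
      have "j - Suc m = i" using i by simp
      then show ?thesis unfolding p_def by (simp add: algebra_simps)
    qed
    have A3: "pochhammer (A - real (Suc j) + real (Suc m) + 1) (Suc j - Suc m) = (A - real j + real m + 1) * p"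
    proof -
      have "A - real (Suc j) + real (Suc m) + 1 = A - real j + real m + 1" by simp
      then show ?thesis unfolding diff_Suc_Suc using A1 by (simp only:)
    qed
    have bin: "real (Suc j choose Suc m) = real (j choose Suc m) + real (j choose m)" by simp
    have "Suc m * (j choose Suc m) = (j - m) * (j choose m)"
      by (simp only: binomial_absorption binomial_absorb_comp)
    from arg_cong[OF this, of real] have "real (Suc m) * real (j choose Suc m) = (real j - real m) * real (j choose m)"
      using 1 by (simp only: of_nat_mult of_nat_diff less_imp_le)
    then have bin2: "(real m + 1) * real (j choose Suc m) = (real j - real m) * real (j choose m)"
      by (simp only: of_nat_Suc add.commute[of 1])
    define c e where "c = real (j choose m)" and "e = real (j choose Suc m)"
    define X Y K where "X = D + 1 - real j + real m" and "Y = real m + D - 2 * real j" and "K = A - real j + real m + 1"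
    have "(e + c) * (D - real j) = e * X + c * Y"
      using bin2 unfolding c_def[symmetric] e_def[symmetric] X_def Y_def by (simp add: algebra_simps)
    moreover have "(e + c) * (K * p) * ((D - real j) * q) = ((e + c) * (D - real j)) * (K * p * q)"
      by (simp only: mult_ac)
    moreover have "\<dots> = K * (e * p * (q * X)) + Y * (c * (K * p) * q)" if "(e + c) * (D - real j) = e * X + c * Y"
      unfolding that by (simp add: algebra_simps)
    ultimately have "(e + c) * (K * p) * ((D - real j) * q) = K * (e * p * (q * X)) + Y * (c * (K * p) * q)"
      by (simp only:)
    moreover have "real m + 1 + A - real j = K" by (simp add: K_def)
    ultimately show ?thesis
      unfolding rodrigues_coeff_def A1 A2 A3 D1 D2 bin
      unfolding c_def[symmetric] e_def[symmetric] q_def[symmetric] X_def[symmetric] Y_def[symmetric] K_def[symmetric] by (simp only:)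
  next
    case 2
    then show ?thesis unfolding rodrigues_coeff_def D1 D2 by (simp add: q_def)
  next
    case 3
    then show ?thesis by (simp add: rodrigues_coeff_def binomial_eq_0)
  qed
qed

lemma rodrigues_coeff_Suc_0:
  "rodrigues_coeff A D (Suc j) 0 = (A - real j) * rodrigues_coeff A D j 0"
  using pochhammer_rec[of "A - real j" j] by (simp add: rodrigues_coeff_def)

lemma coeff_quad_mult_0: "coeff ([:0, 1, 1:] * q) 0 = 0"
  and coeff_quad_mult_Suc_0: "coeff ([:0, 1, 1:] * q) (Suc 0) = coeff q 0"
  and coeff_quad_mult_Suc: "coeff ([:0, 1, 1:] * q) (Suc (Suc m)) = coeff q (Suc m) + coeff q m"
  for q :: "'a::comm_semiring_1 poly"
  by (simp_all add: mult_pCons_left)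

text \<open>The product rule: differentiating \<open>t^(A-j) (1+t)^(-B-j) P\<close> and taking out
  \<open>t^(A-j-1) (1+t)^(-B-j-1)\<close> leaves the factor
  \<open>(A - j) (1 + t) - (B + j) t\<close> in front of \<open>P\<close>, which is
  \<open>(A - j) + (D - 2 j) t\<close>.\<close>

lemma rodrigues_poly_Suc:
  "rodrigues_poly A D (Suc j) =
     [:0, 1, 1:] * pderiv (rodrigues_poly A D j) +
     [:complex_of_real (A - real j), complex_of_real (D - 2 * real j):] * rodrigues_poly A D j"
proof (rule poly_eqI)
  fix k
  show "coeff (rodrigues_poly A D (Suc j)) k = coeff ([:0, 1, 1:] * pderiv (rodrigues_poly A D j) +
     [:complex_of_real (A - real j), complex_of_real (D - 2 * real j):] * rodrigues_poly A D j) k"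
  proof (cases k)
    case 0
    then show ?thesis
      by (simp only: coeff_add coeff_quad_mult_0 coeff_rodrigues_poly rodrigues_coeff_Suc_0)
        (simp add: mult_pCons_left coeff_rodrigues_poly)
  next
    case (Suc m)
    have "coeff ([:0, 1, 1:] * pderiv (rodrigues_poly A D j)) (Suc m) =
        of_real ((real m + 1) * rodrigues_coeff A D j (Suc m) + real m * rodrigues_coeff A D j m)"
      by (cases m) (simp_all only: coeff_quad_mult_Suc coeff_quad_mult_Suc_0 coeff_pderiv coeff_rodrigues_poly,
        simp_all add: algebra_simps)
    then show ?thesis unfolding Suc
      by (simp only: coeff_add coeff_rodrigues_poly rodrigues_coeff_Suc_Suc)
        (simp add: mult_pCons_left coeff_rodrigues_poly algebra_simps)
  qed
qed

lemma degree_rodrigues_poly_le: "degree (rodrigues_poly A D j) \<le> j"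
  by (rule degree_le) (simp add: coeff_rodrigues_poly rodrigues_coeff_def binomial_eq_0)

section \<open>Logarithmic derivatives and the location of the roots\<close>

lemma
  fixes X :: "complex multiset"
  assumes "z \<notin># X"
  shows poly_pderiv_prod_mset: "poly (pderiv (\<Prod>x\<in>#X. [:-x, 1:])) z =
      poly (\<Prod>x\<in>#X. [:-x, 1:]) z * (\<Sum>x\<in>#X. 1 / (z - x))"
    and poly_pderiv2_prod_mset: "poly (pderiv (pderiv (\<Prod>x\<in>#X. [:-x, 1:]))) z =
      poly (\<Prod>x\<in>#X. [:-x, 1:]) z * ((\<Sum>x\<in>#X. 1 / (z - x))\<^sup>2 - (\<Sum>x\<in>#X. 1 / (z - x)\<^sup>2))"
  using assms
proof (induction X)
  case empty
  { case 1 then show ?case by simp }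
  { case 2 then show ?case by simp }
next
  case (add y X)
  define Q where "Q = (\<Prod>x\<in>#X. [:-x, 1:])"
  define L M where "L = (\<Sum>x\<in>#X. 1 / (z - x))" and "M = (\<Sum>x\<in>#X. 1 / (z - x)\<^sup>2)"
  have lin: "pderiv [:-y, 1:] = 1" by (simp add: pderiv_pCons one_pCons)
  have d1: "pderiv ([:-y, 1:] * Q) = [:-y, 1:] * pderiv Q + Q"
    by (subst pderiv_mult) (simp add: lin del: mult_pCons_left)
  have d2: "pderiv (pderiv ([:-y, 1:] * Q)) = [:-y, 1:] * pderiv (pderiv Q) + pderiv Q + pderiv Q"
    unfolding d1 pderiv_add pderiv_mult lin by (simp add: algebra_simps del: mult_pCons_left)
  have eq: "(\<Prod>x\<in>#add_mset y X. [:-x, 1:]) = [:-y, 1:] * Q"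
    by (simp add: Q_def del: mult_pCons_left)
  have v: "poly ([:-y, 1:] * q) z = (z - y) * poly q z" for q by (simp add: algebra_simps)
  { case 1
    then have z: "z - y \<noteq> 0" "z \<notin># X" by auto
    have "poly (pderiv Q) z = poly Q z * L" using add(1) z unfolding Q_def L_def by blast
    with z(1) show ?case
      unfolding eq d1 poly_add v by (simp add: L_def[symmetric] field_simps) }
  { case 2
    then have z: "z - y \<noteq> 0" "z \<notin># X" by auto
    have q: "poly (pderiv Q) z = poly Q z * L" "poly (pderiv (pderiv Q)) z = poly Q z * (L\<^sup>2 - M)"
      using add(1,2) z unfolding Q_def L_def M_def by blast+
    have s: "(\<Sum>x\<in>#add_mset y X. 1 / (z - x)) = 1 / (z - y) + L"
      "(\<Sum>x\<in>#add_mset y X. 1 / (z - x)\<^sup>2) = 1 / (z - y)\<^sup>2 + M"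
      by (simp_all add: L_def M_def)
    have alg: "u * (q * (l\<^sup>2 - m)) + q * l + q * l = u * q * ((1 / u + l)\<^sup>2 - (1 / u\<^sup>2 + m))"
      if "u \<noteq> 0" for u q l m :: complex
      using that by (simp add: field_simps power2_eq_square)
    show ?case unfolding eq d2 poly_add v q s by (rule alg[OF z(1)]) }
qed

lemma
  fixes p :: "complex poly"
  assumes "poly p z \<noteq> 0"
  shows poly_pderiv_proots: "poly (pderiv p) z = poly p z * (\<Sum>x\<in>#proots p. 1 / (z - x))"
    and poly_pderiv2_proots: "poly (pderiv (pderiv p)) z =
      poly p z * ((\<Sum>x\<in>#proots p. 1 / (z - x))\<^sup>2 - (\<Sum>x\<in>#proots p. 1 / (z - x)\<^sup>2))"
proof -
  have p: "p \<noteq> 0" using assms by auto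
  then have z: "z \<notin># proots p" using assms by simp
  define Q where "Q = (\<Prod>x\<in>#proots p. [:- x, 1:])"
  define c where "c = lead_coeff p"
  have eq: "p = smult c Q"
    unfolding Q_def c_def by (rule complex_poly_decompose_multiset[symmetric])
  have "pderiv p = smult c (pderiv Q)" "poly p z = c * poly Q z"
    using arg_cong[OF eq, of pderiv] arg_cong[OF eq, of "\<lambda>p. poly p z"] by (simp_all add: pderiv_smult)
  moreover from this(1) have "pderiv (pderiv p) = smult c (pderiv (pderiv Q))"
    by (simp add: pderiv_smult)
  ultimately show "poly (pderiv p) z = poly p z * (\<Sum>x\<in>#proots p. 1 / (z - x))"
    "poly (pderiv (pderiv p)) z =
      poly p z * ((\<Sum>x\<in>#proots p. 1 / (z - x))\<^sup>2 - (\<Sum>x\<in>#proots p. 1 / (z - x)\<^sup>2))"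
    using poly_pderiv_prod_mset[OF z] poly_pderiv2_prod_mset[OF z] unfolding Q_def[symmetric] by simp_all
qed

lemma sum_mset_Re: "Re (\<Sum>x\<in>#X. f x) = (\<Sum>x\<in>#X. Re (f x))"
  and sum_mset_Im: "Im (\<Sum>x\<in>#X. f x) = (\<Sum>x\<in>#X. Im (f x))"
  by (induction X) auto

lemma sum_mset_nonpos: "(\<And>x. x \<in># X \<Longrightarrow> f x \<le> 0) \<Longrightarrow> (\<Sum>x\<in>#X. f x) \<le> (0::real)"
  by (induction X) (auto intro: add_nonpos_nonpos)

lemma not_positive_real_cases:
  assumes "z \<notin> complex_of_real ` {0<..}"
  obtains "Im z \<noteq> 0" | x where "x \<le> 0" "z = complex_of_real x"
proof (cases "Im z = 0")
  case True
  then have z: "z = complex_of_real (Re z)" by (simp add: complex_eq_iff)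
  then have "\<not> Re z > 0" using assms by (metis greaterThan_iff image_eqI)
  then show ?thesis using that(2)[of "Re z"] z by simp
qed (use that in blast)

text \<open>Gauss--Lucas after the change of variable \<open>y = 1 / (1 + t)\<close>: up to a factor, the new polynomial is the
  logarithmic derivative of \<open>p\<close> times powers of \<open>t\<close> and \<open>1 + t\<close>, and off the positive half-line all
  its terms lie in a common half-plane.\<close>

lemma roots_positive_step:
  fixes p :: "complex poly"
  assumes p0: "p \<noteq> 0" and roots: "\<And>z. poly p z = 0 \<Longrightarrow> z \<in> complex_of_real ` {0<..}"
    and \<alpha>: "\<alpha> > 0" and \<beta>: "real (degree p) + \<beta> \<le> 0"
    and root: "poly ([:0, 1, 1:] * pderiv p + [:complex_of_real \<alpha>, complex_of_real \<beta>:] * p) z = 0"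
  shows "z \<in> complex_of_real ` {0<..}"
proof (rule ccontr)
  assume z: "z \<notin> complex_of_real ` {0<..}"
  then have pz: "poly p z \<noteq> 0" using roots by blast
  have \<beta>0: "\<beta> \<le> 0" using \<beta> by linarith
  have z0: "z \<noteq> 0" using root pz \<alpha> by auto
  define X m where "X = proots p" and "m = real (degree p)"
  have m: "m = real (size X)" by (simp add: m_def X_def size_proots_complex)
  have X: "\<exists>r>0. x = complex_of_real r" "x \<noteq> z" if "x \<in># X" for x
    using that roots[of x] p0 pz by (auto simp: X_def)
  \<comment> \<open>The polynomial divided by \<open>z * p\<close>, after
    \<open>(1 + z) / (z - x) = (1 + x) / (z - x) + 1\<close>: simple poles with positive numerators
    \<open>1 + x\<close> and \<open>\<alpha>\<close>, and a real constant that is nonpositive by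
    hypothesis.\<close>
  define E where "E = (\<Sum>x\<in>#X. (1 + x) / (z - x)) + of_real \<alpha> / z + of_real (m + \<beta>)"
  have E: "E = 0"
  proof -
    have "z * (1 + z) * (poly p z * (\<Sum>x\<in>#X. 1 / (z - x))) + (of_real \<alpha> + of_real \<beta> * z) * poly p z = 0"
      using root poly_pderiv_proots[OF pz] by (simp add: X_def algebra_simps)
    then have "poly p z * (z * (1 + z) * (\<Sum>x\<in>#X. 1 / (z - x)) + (of_real \<alpha> + of_real \<beta> * z)) = 0"
      by (simp add: algebra_simps)
    then have 1: "z * (1 + z) * (\<Sum>x\<in>#X. 1 / (z - x)) + (of_real \<alpha> + of_real \<beta> * z) = 0"
      using pz by simp
    have "(\<Sum>x\<in>#X. (1 + x) / (z - x)) + of_nat (size X) = (1 + z) * (\<Sum>x\<in>#X. 1 / (z - x))"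
      using X(2)
    proof (induction X)
      case (add x X)
      then have "z - x \<noteq> 0" by auto
      then have "(1 + x) / (z - x) + 1 = (1 + z) * (1 / (z - x))" by (simp add: field_simps)
      moreover have "(\<Sum>x\<in>#X. (1 + x) / (z - x)) + of_nat (size X) = (1 + z) * (\<Sum>x\<in>#X. 1 / (z - x))"
        using add by auto
      moreover have "(\<Sum>x\<in>#add_mset x X. (1 + x) / (z - x)) + of_nat (size (add_mset x X)) =
          ((1 + x) / (z - x) + 1) + ((\<Sum>x\<in>#X. (1 + x) / (z - x)) + of_nat (size X))"
        by simp
      moreover have "(\<Sum>x\<in>#add_mset x X. 1 / (z - x)) = 1 / (z - x) + (\<Sum>x\<in>#X. 1 / (z - x))"
        by simp
      ultimately show ?case by (simp only: distrib_left)
    qed simp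
    then have "z * E = z * (1 + z) * (\<Sum>x\<in>#X. 1 / (z - x)) + (of_real \<alpha> + of_real \<beta> * z)"
      using z0 unfolding E_def m by (simp add: algebra_simps)
    with 1 z0 show ?thesis by simp
  qed
  from z show False
  proof (rule not_positive_real_cases)
    assume im: "Im z \<noteq> 0"
    \<comment> \<open>The factor \<open>Im z\<close> treats both half-planes at once. The pole at 0
      makes the total strictly negative even if \<open>p\<close> has no roots.\<close>
    have neg: "Im (of_real c / (z - of_real r)) * Im z < 0" if "c > 0" for c r
    proof -
      have "Im (of_real c / (z - of_real r)) * Im z = - (c * (Im z)\<^sup>2 / (norm (z - of_real r))\<^sup>2)"
        by (simp add: Im_divide cmod_power2) (simp add: power2_eq_square)
      moreover have "norm (z - of_real r) > 0" using im by auto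
      ultimately show ?thesis using that im by simp
    qed
    have "(\<Sum>x\<in>#X. Im ((1 + x) / (z - x)) * Im z) \<le> 0"
    proof (rule sum_mset_nonpos)
      fix x assume "x \<in># X"
      then obtain r where "r > 0" "x = of_real r" using X by blast
      then show "Im ((1 + x) / (z - x)) * Im z \<le> 0"
        using neg[of "1 + r" r] by simp
    qed
    moreover have "Im (of_real \<alpha> / z) * Im z < 0"
      using neg[OF \<alpha>, of 0] by simp
    moreover have "Im E * Im z = (\<Sum>x\<in>#X. Im ((1 + x) / (z - x)) * Im z) + Im (of_real \<alpha> / z) * Im z"
      unfolding E_def by (simp add: sum_mset_Im sum_mset_distrib_left algebra_simps del: Im_divide_of_real)
    ultimately show False using E by simp
  next
    fix x0 assume x0: "x0 \<le> 0" "z = complex_of_real x0"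
    then have x0: "x0 < 0" "z = complex_of_real x0" using z0 by auto
    have "(\<Sum>x\<in>#X. Re ((1 + x) / (z - x))) \<le> 0"
    proof (rule sum_mset_nonpos)
      fix x assume "x \<in># X"
      then obtain r where r: "r > 0" "x = of_real r" using X by blast
      have "(1 + x) / (z - x) = of_real ((1 + r) / (x0 - r))" by (simp add: x0 r)
      then have "Re ((1 + x) / (z - x)) = (1 + r) / (x0 - r)" by (simp only: Re_complex_of_real)
      then show "Re ((1 + x) / (z - x)) \<le> 0"
        using r x0 by (simp add: divide_nonneg_neg)
    qed
    moreover have "Re (of_real \<alpha> / z) < 0"
      using x0 \<alpha> by (simp add: divide_pos_neg)
    moreover have "Re E = (\<Sum>x\<in>#X. Re ((1 + x) / (z - x))) + Re (of_real \<alpha> / z) + (m + \<beta>)"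
      unfolding E_def by (simp add: sum_mset_Re)
    ultimately show False using E \<beta> by (simp add: m_def)
  qed
qed

text \<open>The conditions of the step persist up to \<open>j = n - 1\<close>:
  \<open>n \<le> A\<close> keeps \<open>A - j\<close> positive, and a degree of at most
  \<open>j\<close> gives \<open>j + D - 2 j \<le> 0\<close>.\<close>

lemma rodrigues_poly_roots:
  assumes "D \<le> 0" "j \<le> n" "real n \<le> A"
  shows "rodrigues_poly A D j \<noteq> 0 \<and> (\<forall>z. poly (rodrigues_poly A D j) z = 0 \<longrightarrow> z \<in> complex_of_real ` {0<..})"
  using assms(2)
proof (induction j)
  case 0
  have "rodrigues_poly A D 0 = 1" by (simp add: rodrigues_poly_def rodrigues_coeff_def one_pCons)
  then show ?case by simp
next
  case (Suc j)
  let ?p = "rodrigues_poly A D j"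
  have IH: "?p \<noteq> 0" "\<And>z. poly ?p z = 0 \<Longrightarrow> z \<in> complex_of_real ` {0<..}"
    using Suc by auto
  have "z \<in> complex_of_real ` {0<..}" if "poly (rodrigues_poly A D (Suc j)) z = 0" for z
  proof (rule roots_positive_step[OF IH])
    show "A - real j > 0" using Suc.prems assms(3) by linarith
    show "real (degree ?p) + (D - 2 * real j) \<le> 0"
      using degree_rodrigues_poly_le[of A D j] assms(1) by linarith
    show "poly ([:0, 1, 1:] * pderiv ?p + [:complex_of_real (A - real j), complex_of_real (D - 2 * real j):] * ?p) z = 0"
      using that unfolding rodrigues_poly_Suc .
  qed
  \<comment> \<open>The zero polynomial would have the root 0, which is not positive.\<close>
  moreover have "rodrigues_poly A D (Suc j) \<noteq> 0"
  proof
    assume "rodrigues_poly A D (Suc j) = 0"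
    then have "0 \<in> complex_of_real ` {0<..}" using calculation[of 0] by simp
    then show False by auto
  qed
  ultimately show ?case by blast
qed

text \<open>Coefficientwise the equation is the two-term recursion \<open>rec\<close>, that of the
  hypergeometric series \<open>2F1(-n, D + 1 - n; A - n + 1; -t)\<close>.\<close>

lemma rodrigues_poly_ode:
  "[:0, 1, 1:] * pderiv (pderiv (rodrigues_poly A D n)) +
     [:complex_of_real (A - real n + 1), complex_of_real (D + 2 - 2 * real n):] * pderiv (rodrigues_poly A D n)
     - smult (complex_of_real (real n * (D + 1 - real n))) (rodrigues_poly A D n) = 0"
proof -
  define r where "r = rodrigues_coeff A D n"
  have rec: "r (Suc k) * (real k + 1) * (A - real n + 1 + real k) = (real n - real k) * (D + 1 - real n + real k) * r k" for k
  proof -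
    consider "k < n" | "k = n" | "k > n" by linarith
    then show ?thesis
    proof cases
      case 1
      then obtain i where i: "n - k = Suc i" by (metis Suc_diff_Suc)
      define p q where "p = pochhammer (A - real n + real k + 2) i" and "q = pochhammer (D + 1 - real n) k"
      have A1: "pochhammer (A - real n + real k + 1) (n - k) = (A - real n + real k + 1) * p"
        unfolding i p_def by (simp add: pochhammer_rec add.assoc)
      have A2: "pochhammer (A - real n + real (Suc k) + 1) (n - Suc k) = p"
      proof -
        have "n - Suc k = i" using i by simp
        then show ?thesis unfolding p_def by (simp add: algebra_simps)
      qed
      have "Suc k * (n choose Suc k) = (n - k) * (n choose k)"
        by (simp only: binomial_absorption binomial_absorb_comp)
      from arg_cong[OF this, of real] have "real (Suc k) * real (n choose Suc k) = (real n - real k) * real (n choose k)"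
        using 1 by (simp only: of_nat_mult of_nat_diff less_imp_le)
      then have bin2: "(real k + 1) * real (n choose Suc k) = (real n - real k) * real (n choose k)"
        by (simp only: of_nat_Suc add.commute[of 1])
      define X K where "X = D + 1 - real n + real k" and "K = A - real n + real k + 1"
      have "real (n choose Suc k) * p * (q * X) * (real k + 1) * K = ((real k + 1) * real (n choose Suc k)) * (p * q * X * K)"
        by (simp only: mult_ac)
      also have "\<dots> = (real n - real k) * X * (real (n choose k) * (K * p) * q)"
        unfolding bin2 by (simp only: mult_ac)
      finally have "real (n choose Suc k) * p * (q * X) * (real k + 1) * K = (real n - real k) * X * (real (n choose k) * (K * p) * q)" .
      moreover have "A - real n + 1 + real k = K" by (simp add: K_def)
      ultimately show ?thesis
        unfolding r_def rodrigues_coeff_def A1 A2 pochhammer_Suc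
        unfolding q_def[symmetric] X_def[symmetric] K_def[symmetric] by (simp only:)
    qed (simp_all add: r_def rodrigues_coeff_def binomial_eq_0)
  qed
  have c: "coeff (rodrigues_poly A D n) k = of_real (r k)" for k
    by (simp add: r_def coeff_rodrigues_poly)
  show ?thesis
  proof (rule poly_eqI)
    fix k
    have quad: "coeff ([:0, 1, 1:] * pderiv (pderiv (rodrigues_poly A D n))) k =
        of_real (real k * (real k + 1) * r (Suc k) + real k * (real k - 1) * r k)"
    proof -
      consider "k = 0" | "k = Suc 0" | m where "k = Suc (Suc m)" by (metis not0_implies_Suc)
      then show ?thesis
        by cases (simp_all only: coeff_quad_mult_0 coeff_quad_mult_Suc_0 coeff_quad_mult_Suc coeff_pderiv c,
          simp_all add: algebra_simps)
    qed
    have lin: "coeff ([:complex_of_real \<alpha>, complex_of_real \<beta>:] * pderiv (rodrigues_poly A D n)) k =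
        of_real (\<alpha> * (real k + 1) * r (Suc k) + \<beta> * real k * r k)" for \<alpha> \<beta>
      by (cases k) (simp_all add: mult_pCons_left coeff_pderiv c algebra_simps)
    have "real k * (real k + 1) * r (Suc k) + real k * (real k - 1) * r k +
        ((A - real n + 1) * (real k + 1) * r (Suc k) + (D + 2 - 2 * real n) * real k * r k) -
        real n * (D + 1 - real n) * r k = 0"
      using rec[of k] by (simp add: algebra_simps)
    then have "complex_of_real (real k * (real k + 1) * r (Suc k) + real k * (real k - 1) * r k +
        ((A - real n + 1) * (real k + 1) * r (Suc k) + (D + 2 - 2 * real n) * real k * r k) -
        real n * (D + 1 - real n) * r k) = 0" by (simp only: of_real_0)
    then show "coeff ([:0, 1, 1:] * pderiv (pderiv (rodrigues_poly A D n)) +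
        [:complex_of_real (A - real n + 1), complex_of_real (D + 2 - 2 * real n):] * pderiv (rodrigues_poly A D n)
        - smult (complex_of_real (real n * (D + 1 - real n))) (rodrigues_poly A D n)) k = coeff 0 k"
      unfolding coeff_add coeff_diff coeff_smult quad lin c coeff_0
      by (simp only: of_real_add of_real_diff of_real_mult)
  qed
qed


section \<open>Finite free convolutions and the polynomials \<open>p\<^bsub>n,(a,b)\<^esub>\<close>\<close>

lemma coeff_poly_of_norm_coeffs:
  "coeff (poly_of_norm_coeffs n e) i = (if i \<le> n then (-1) ^ (n - i) * of_nat (n choose i) * e (n - i) else 0)"
proof -
  have "coeff (poly_of_norm_coeffs n e) i =
      (\<Sum>k\<le>n. if n - k = i then (-1) ^ k * of_nat (n choose k) * e k else 0)"
    by (simp add: poly_of_norm_coeffs_def coeff_sum)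
  also have "\<dots> = (if i \<le> n then (-1) ^ (n - i) * of_nat (n choose i) * e (n - i) else 0)"
  proof (cases "i \<le> n")
    case True
    then have "(\<Sum>k\<le>n. if n - k = i then (-1) ^ k * of_nat (n choose k) * e k else 0) =
        (\<Sum>k\<le>n. if k = n - i then (-1) ^ k * of_nat (n choose k) * e k else 0)"
      by (intro sum.cong) auto
    then show ?thesis using True by (simp add: binomial_symmetric[symmetric])
  next
    case False
    then show ?thesis by (auto intro!: sum.neutral)
  qed
  finally show ?thesis .
qed

lemma norm_coeff_poly_of_norm_coeffs:
  "k \<le> n \<Longrightarrow> norm_coeff n (poly_of_norm_coeffs n e) k = e k"
  by (simp add: norm_coeff_def coeff_poly_of_norm_coeffs binomial_symmetric[symmetric] flip: power_mult_distrib)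

lemma poly_of_norm_coeffs_norm_coeff:
  assumes "degree p \<le> n" "\<And>k. k \<le> n \<Longrightarrow> e k = norm_coeff n p k"
  shows "poly_of_norm_coeffs n e = p"
proof (rule poly_eqI)
  fix i show "coeff (poly_of_norm_coeffs n e) i = coeff p i"
    using assms(1) by (auto simp: coeff_poly_of_norm_coeffs assms(2) norm_coeff_def coeff_eq_0
        binomial_symmetric[symmetric] simp flip: power_mult_distrib)
qed

lemma norm_coeff_smult: "norm_coeff n (smult c p) k = c * norm_coeff n p k"
  by (simp add: norm_coeff_def)

text \<open>The coefficients are polynomial in \<open>b\<close>, so \<open>b = 1\<close> is not
  singular; there merely the leading coefficient vanishes.\<close>

abbreviation hyp_rodrigues :: "nat \<Rightarrow> real \<Rightarrow> real \<Rightarrow> complex poly" where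
  "hyp_rodrigues n a b \<equiv> rodrigues_poly (a * real n) ((1 - b) * real n) n"

lemma norm_coeff_hyp_rodrigues:
  assumes "k \<le> n"
  shows "norm_coeff n (hyp_rodrigues n a b) k =
    of_real (pochhammer (- a * real n) k * pochhammer (1 - b * real n) (n - k))"
proof -
  have "pochhammer (- (a * real n)) k = (-1) ^ k * pochhammer (a * real n - real k + 1) k"
    by (rule pochhammer_minus)
  moreover have "pochhammer ((1 - b) * real n + 1 - real n) (n - k) = pochhammer (1 - b * real n) (n - k)"
    by (simp add: algebra_simps)
  moreover have "a * real n - real n + real (n - k) + 1 = a * real n - real k + 1" using assms by (simp add: of_nat_diff)
  ultimately show ?thesis
    using assms by (simp add: norm_coeff_def coeff_rodrigues_poly rodrigues_coeff_def binomial_symmetric[symmetric])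
qed

text \<open>With \<open>s = (b - 1) n\<close>, multiplication by the Pochhammer symbol
  \<open>(s)_n\<close> turns \<open>1 / (s)_k\<close> into \<open>(s + k)_(n-k)\<close>, which by
  reflection is \<open>(1 - b n)_(n-k)\<close> up to sign.\<close>

lemma hyp_poly_gt1_eq:
  assumes "b > 1" "n \<ge> 1"
  shows "hyp_poly_gt1 n a b = smult (of_real ((-1) ^ n / pochhammer ((b - 1) * real n) n)) (hyp_rodrigues n a b)"
  unfolding hyp_poly_gt1_def
proof (rule poly_of_norm_coeffs_norm_coeff)
  show "degree (smult (of_real ((-1) ^ n / pochhammer ((b - 1) * real n) n)) (hyp_rodrigues n a b)) \<le> n"
    using degree_rodrigues_poly_le degree_smult_le order_trans by blast
  fix k assume k: "k \<le> n"
  define s where "s = (b - 1) * real n"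
  have s: "s > 0" using assms by (simp add: s_def)
  have 1: "pochhammer s n = pochhammer s k * pochhammer (s + real k) (n - k)"
    by (rule pochhammer_product[OF k])
  have "pochhammer (- (b * real n - 1)) (n - k) =
      (-1) ^ (n - k) * pochhammer (b * real n - 1 - real (n - k) + 1) (n - k)"
    by (rule pochhammer_minus)
  moreover have "- (b * real n - 1) = 1 - b * real n" by simp
  moreover have "b * real n - 1 - real (n - k) + 1 = s + real k"
    using k by (simp add: s_def of_nat_diff algebra_simps)
  ultimately have 2: "pochhammer (1 - b * real n) (n - k) = (-1) ^ (n - k) * pochhammer (s + real k) (n - k)"
    by (simp only:)
  have pos: "pochhammer s k > 0" "pochhammer (s + real k) (n - k) > 0"
    using s by (auto intro!: pochhammer_pos)
  have "(-1) ^ n * (-1) ^ (n - k) = ((-1) ^ k :: real)"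
  proof -
    define m where "m = n - k"
    then have "n = k + m" using k by simp
    then show ?thesis unfolding m_def[symmetric] by (simp add: power_add mult.assoc flip: power_mult_distrib)
  qed
  then have "(-1) ^ k * (pochhammer (- a * real n) k / pochhammer s k) =
      (-1) ^ n / pochhammer s n * (pochhammer (- a * real n) k * pochhammer (1 - b * real n) (n - k))"
    unfolding 1 2 using pos by (simp add: field_simps)
  from arg_cong[OF this, of complex_of_real]
  show "(-1) ^ k * complex_of_real (pochhammer (- a * real n) k / pochhammer ((b - 1) * real n) k) =
      norm_coeff n (smult (of_real ((-1) ^ n / pochhammer ((b - 1) * real n) n)) (hyp_rodrigues n a b)) k"
    unfolding norm_coeff_smult norm_coeff_hyp_rodrigues[OF k] s_def by simp
qed

lemma tendsto_poly_hyp_rodrigues: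
  "((\<lambda>b'. poly (hyp_rodrigues n a b') z) \<longlongrightarrow> poly (hyp_rodrigues n a b) z) (at_right b)"
proof -
  have "isCont (\<lambda>b'. poly (hyp_rodrigues n a b') z) b"
    unfolding rodrigues_poly_def rodrigues_coeff_def pochhammer_prod
    by (simp add: poly_sum poly_monom) (intro continuous_intros)
  then show ?thesis
    using isCont_def tendsto_within_subset by blast
qed

text \<open>With \<open>s = (b' - 1) n\<close> the first normalized coefficient is
  \<open>a n / s\<close>, while \<open>(s)_n\<close> has the simple factor \<open>s\<close>. The two
  cancel, so the quotient is a multiple of \<open>hyp_rodrigues\<close> by a constant continuous at
  \<open>b' = 1\<close>.\<close>

lemma hyp_poly_1_eq:
  assumes "a > 0" "n \<ge> 1"
  shows "hyp_poly n a 1 =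
    smult (of_real (- ((-1) ^ n) / (a * (real n)\<^sup>2 * pochhammer 1 (n - 1)))) (hyp_rodrigues n a 1)"
    (is "_ = ?p")
proof -
  let ?f = "\<lambda>b' z. poly (hyp_poly_gt1 n a b') z / (- of_nat n * norm_coeff n (hyp_poly_gt1 n a b') 1)"
  let ?s = "\<lambda>b'. - ((-1) ^ n) / (a * (real n)\<^sup>2 * pochhammer ((b' - 1) * real n + 1) (n - 1))"
  have n: "real n > 0" using assms by simp
  have eq: "?f b' z = of_real (?s b') * poly (hyp_rodrigues n a b') z" if b': "b' > 1" for b' z
  proof -
    define s where "s = (b' - 1) * real n"
    have s: "s > 0" using b' n by (simp add: s_def)
    obtain m where m: "n = Suc m" using assms by (cases n) auto
    have p: "pochhammer s n = s * pochhammer (s + 1) (n - 1)" by (simp add: m pochhammer_rec)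
    have pos: "pochhammer (s + 1) (n - 1) > 0" using s by (intro pochhammer_pos) simp
    have "norm_coeff n (hyp_poly_gt1 n a b') 1 = of_real (a * real n / s)"
      using assms unfolding hyp_poly_gt1_def by (subst norm_coeff_poly_of_norm_coeffs) (auto simp: s_def)
    then have "?f b' z = of_real ((-1) ^ n / pochhammer s n / (- real n * (a * real n / s))) * poly (hyp_rodrigues n a b') z"
      using assms b' by (simp add: hyp_poly_gt1_eq s_def)
    also have "(-1) ^ n / pochhammer s n / (- real n * (a * real n / s)) = ?s b'"
      unfolding p s_def[symmetric] using s pos assms n by (simp add: field_simps power2_eq_square)
    finally show ?thesis .
  qed
  have lim: "((\<lambda>b'. ?f b' z) \<longlongrightarrow> poly ?p z) (at_right 1)" for z
  proof -
    have "isCont ?s 1"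
      using assms n pochhammer_pos[of "1 :: real" "n - 1"] unfolding pochhammer_prod
      by (intro continuous_intros) auto
    then have "(?s \<longlongrightarrow> ?s 1) (at_right 1)"
      using isCont_def tendsto_within_subset by blast
    then have "((\<lambda>b'. of_real (?s b') * poly (hyp_rodrigues n a b') z) \<longlongrightarrow>
        of_real (?s 1) * poly (hyp_rodrigues n a 1) z) (at_right 1)"
      by (intro tendsto_mult tendsto_of_real tendsto_poly_hyp_rodrigues)
    moreover have "of_real (?s 1) * poly (hyp_rodrigues n a 1) z = poly ?p z" by simp
    moreover have "eventually (\<lambda>b'. of_real (?s b') * poly (hyp_rodrigues n a b') z = ?f b' z) (at_right 1)"
      using eq by (auto simp: eventually_at_right_field intro!: exI[of _ 2])
    ultimately show ?thesis using Lim_transform_eventually by force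
  qed
  have "(THE p. \<forall>z. ((\<lambda>b'. ?f b' z) \<longlongrightarrow> poly p z) (at_right 1)) = ?p"
  proof (rule the_equality)
    fix p assume "\<forall>z. ((\<lambda>b'. ?f b' z) \<longlongrightarrow> poly p z) (at_right 1)"
    then have "poly p z = poly ?p z" for z
      using lim[of z] by (intro tendsto_unique[of "at_right (1::real)"]) auto
    then show "p = ?p" by (simp add: poly_eq_poly_eq_iff[symmetric] fun_eq_iff)
  qed (use lim in blast)
  then show ?thesis by (simp add: hyp_poly_def)
qed

text \<open>Passing to a scalar multiple is harmless: roots do not see it, and the finite free
  identity is linear in this polynomial.\<close>

lemma hyp_poly_eq:
  assumes "a > 0" "b \<ge> 1" "n \<ge> 1"
  obtains C where "C \<noteq> 0" "hyp_poly n a b = smult C (hyp_rodrigues n a b)"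
proof (cases "b > 1")
  case True
  then have "pochhammer ((b - 1) * real n) n > 0" using assms by (intro pochhammer_pos) simp
  moreover have "hyp_poly n a b = smult (of_real ((-1) ^ n / pochhammer ((b - 1) * real n) n)) (hyp_rodrigues n a b)"
    using True hyp_poly_gt1_eq[OF True assms(3)] by (simp add: hyp_poly_def)
  ultimately show ?thesis by (intro that) auto
next
  case False
  then have b: "b = 1" using assms by simp
  have "pochhammer (1::real) (n - 1) > 0" by (intro pochhammer_pos) simp
  then have "complex_of_real (- ((-1) ^ n) / (a * (real n)\<^sup>2 * pochhammer 1 (n - 1))) \<noteq> 0"
    using assms by simp
  from that[OF this] show ?thesis using hyp_poly_1_eq[OF assms(1,3)] unfolding b by blast
qed

lemma hyp_poly_roots:
  assumes "a \<ge> 1" "b \<ge> 1" "n \<ge> 1" "poly (hyp_poly n a b) z = 0"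
  shows "z \<in> complex_of_real ` {0<..}"
proof -
  obtain C where C: "C \<noteq> 0" "hyp_poly n a b = smult C (hyp_rodrigues n a b)"
    using hyp_poly_eq[of a b n] assms by auto
  have "(1 - b) * real n \<le> 0" "real n \<le> a * real n"
    using assms by (auto simp: mult_nonpos_nonneg)
  then show ?thesis
    using rodrigues_poly_roots[of "(1 - b) * real n" n n "a * real n"] assms C by auto
qed

section \<open>The finite free identity\<close>

lemma norm_coeff_finite_free_unit: "k \<le> n \<Longrightarrow> norm_coeff n (finite_free_unit n) k = 1"
  by (simp add: norm_coeff_def finite_free_unit_def coeff_linear_poly_power binomial_symmetric[symmetric]
      flip: power_mult_distrib)

text \<open>Comparing coefficients, this is the Chu--Vandermonde identity.\<close>

lemma hyp_poly_finite_free: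
  assumes "a > 0" "b \<ge> 1" "n \<ge> 1"
  shows "hyp_poly n a b = finite_free_mult n (hyp_poly n a (a + b))
    (finite_free_add n (finite_free_unit n) (hyp_poly n a b))"
proof -
  obtain C where C: "hyp_poly n a b = smult C (hyp_rodrigues n a b)"
    using hyp_poly_eq[of a b n] assms by auto
  define N where "N k = pochhammer (- a * real n) k * pochhammer (1 - b * real n) (n - k)" for k
  define s where "s = (a + b - 1) * real n"
  have s: "s > 0" using assms by (simp add: s_def)
  have main: "(-1) ^ k * (pochhammer (- a * real n) k / pochhammer s k) * (\<Sum>j\<le>k. real (k choose j) * N (k - j)) = N k"
    if k: "k \<le> n" for k
  proof -
    \<comment> \<open>Splitting \<open>n - (k - j)\<close> as \<open>(n - k) + j\<close> takes a
      Pochhammer factor free of \<open>j\<close> out of the sum.\<close>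
    have "N (k - j) = pochhammer (1 - b * real n) (n - k) *
        (pochhammer (1 - b * real n + real (n - k)) j * pochhammer (- a * real n) (k - j))" if "j \<le> k" for j
    proof -
      have "n - (k - j) = (n - k) + j" using that k by simp
      then show ?thesis unfolding N_def by (simp only: pochhammer_product' mult_ac)
    qed
    then have "(\<Sum>j\<le>k. real (k choose j) * N (k - j)) = pochhammer (1 - b * real n) (n - k) *
        (\<Sum>j\<le>k. real (k choose j) * pochhammer (1 - b * real n + real (n - k)) j * pochhammer (- a * real n) (k - j))"
      by (simp add: sum_distrib_left mult_ac)
    also have "(\<Sum>j\<le>k. real (k choose j) * pochhammer (1 - b * real n + real (n - k)) j * pochhammer (- a * real n) (k - j)) =
        pochhammer (1 - b * real n + real (n - k) + - a * real n) k"
      by (rule pochhammer_binomial_sum[symmetric])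
    \<comment> \<open>Reflection of this argument yields \<open>(-1) ^ k * pochhammer s k\<close>,
      which cancels the sign and the denominator in the coefficient of
      \<open>hyp_poly n a (a + b)\<close>.\<close>
    also have "1 - b * real n + real (n - k) + - a * real n = - (s + real k - 1)"
      using k by (simp add: s_def of_nat_diff algebra_simps)
    also have "pochhammer (- (s + real k - 1)) k = (-1) ^ k * pochhammer s k"
      by (subst pochhammer_minus) simp
    finally have sum: "(\<Sum>j\<le>k. real (k choose j) * N (k - j)) =
        pochhammer (1 - b * real n) (n - k) * ((-1) ^ k * pochhammer s k)" .
    have "pochhammer s k > 0" using s by (rule pochhammer_pos)
    moreover have "(-1) ^ k * (-1) ^ k = (1 :: real)" by (simp flip: power_mult_distrib)
    ultimately show ?thesis unfolding sum unfolding N_def by (simp add: field_simps)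
  qed
  show ?thesis unfolding finite_free_mult_def
  proof (rule poly_of_norm_coeffs_norm_coeff[symmetric])
    show "degree (hyp_poly n a b) \<le> n"
      unfolding C using degree_rodrigues_poly_le degree_smult_le order_trans by blast
    fix k assume k: "k \<le> n"
    have A: "norm_coeff n (hyp_poly n a (a + b)) k = of_real ((-1) ^ k * (pochhammer (- a * real n) k / pochhammer s k))"
      using assms k by (simp add: hyp_poly_def hyp_poly_gt1_def norm_coeff_poly_of_norm_coeffs s_def)
    have "norm_coeff n (finite_free_add n (finite_free_unit n) (hyp_poly n a b)) k =
        C * of_real (\<Sum>j\<le>k. real (k choose j) * N (k - j))"
      unfolding finite_free_add_def norm_coeff_poly_of_norm_coeffs[OF k] C of_real_sum sum_distrib_left
      using k by (intro sum.cong refl)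
        (simp add: norm_coeff_finite_free_unit norm_coeff_smult norm_coeff_hyp_rodrigues N_def)
    then have "norm_coeff n (hyp_poly n a (a + b)) k *
        norm_coeff n (finite_free_add n (finite_free_unit n) (hyp_poly n a b)) k =
        C * of_real ((-1) ^ k * (pochhammer (- a * real n) k / pochhammer s k) * (\<Sum>j\<le>k. real (k choose j) * N (k - j)))"
      unfolding A by (simp only: of_real_mult mult_ac)
    also have "\<dots> = norm_coeff n (hyp_poly n a b) k"
      by (simp only: main[OF k] C norm_coeff_smult norm_coeff_hyp_rodrigues[OF k] N_def[symmetric])
    finally show "norm_coeff n (hyp_poly n a (a + b)) k *
        norm_coeff n (finite_free_add n (finite_free_unit n) (hyp_poly n a b)) k = norm_coeff n (hyp_poly n a b) k" .
  qed
qed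


section \<open>Root distributions and the Riccati equation\<close>

lemma sum_mset_count:
  fixes f :: "'a \<Rightarrow> real"
  assumes "finite A" "set_mset X \<subseteq> A"
  shows "(\<Sum>x\<in>#X. f x) = (\<Sum>x\<in>A. real (count X x) * f x)"
  using assms(2)
proof (induction X)
  case (add y X)
  have "(\<Sum>x\<in>A. real (count (add_mset y X) x) * f x) =
      (\<Sum>x\<in>A. (if x = y then f x else 0) + real (count X x) * f x)"
    by (intro sum.cong) (auto simp: algebra_simps)
  then show ?case using add assms(1) by (simp add: sum.distrib)
qed simp

lemma real_distribution_root_distribution: "real_distribution (root_distribution p)"
proof -
  have "prob_space (root_distribution p)"
    unfolding root_distribution_def by (intro prob_space.prob_space_distr prob_space_measure_pmf) simp
  then show ?thesis
    by (simp add: real_distribution_def real_distribution_axioms_def root_distribution_def)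
qed

lemma nonneg_distribution_root_distribution:
  assumes "proots p \<noteq> {#}" "\<And>z. z \<in># proots p \<Longrightarrow> 0 \<le> Re z"
  shows "nonneg_distribution (root_distribution p)"
proof -
  have "AE t in root_distribution p. 0 \<le> t"
    unfolding root_distribution_def using assms
    by (subst AE_distr_iff) (auto simp: AE_measure_pmf_iff)
  then show ?thesis
    by (simp add: nonneg_distribution_def real_distribution_root_distribution)
qed

lemma integral_root_distribution:
  assumes "proots p \<noteq> {#}" and [measurable]: "f \<in> borel_measurable borel"
  shows "(LINT t|root_distribution p. f t) = (\<Sum>z\<in>#proots p. f (Re z)) / real (size (proots p))"
proof -
  let ?X = "proots p"
  have "(LINT t|root_distribution p. f t) = (LINT z|measure_pmf (pmf_of_multiset ?X). f (Re z))"
    unfolding root_distribution_def by (intro integral_distr) simp_all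
  also have "\<dots> = (\<Sum>z\<in>set_mset ?X. f (Re z) * pmf (pmf_of_multiset ?X) z)"
    using assms(1) by (intro integral_measure_pmf_real) auto
  also have "\<dots> = (\<Sum>z\<in>set_mset ?X. real (count ?X z) * f (Re z)) / real (size ?X)"
    using assms(1) by (simp add: sum_divide_distrib mult.commute)
  finally show ?thesis by (simp add: sum_mset_count[of "set_mset ?X"])
qed

text \<open>Its zero is \<open>x = 1 + \<Psi>(1/w)\<close>, by the formula for the \<open>S\<close>-transform of \<open>f\<B>'\<^bsub>a,b\<^esub>\<close>.\<close>

definition beta_quad :: "real \<Rightarrow> real \<Rightarrow> real \<Rightarrow> real \<Rightarrow> real" where
  "beta_quad a b w x = (1 + w) * x\<^sup>2 + (a - 1 - (1 + b) * w) * x + b * w"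

lemma of_real_sum_mset: "of_real (\<Sum>x\<in>#X. f x) = (\<Sum>x\<in>#X. of_real (f x))"
  by (induction X) auto

lemma sum_mset_bounds:
  fixes f :: "'a \<Rightarrow> real"
  assumes "\<And>x. x \<in># X \<Longrightarrow> 0 \<le> f x" "\<And>x. x \<in># X \<Longrightarrow> f x \<le> 1"
  shows "0 \<le> (\<Sum>x\<in>#X. f x)" "(\<Sum>x\<in>#X. f x) \<le> real (size X)"
  using assms by (induction X) (auto, force)

text \<open>The top coefficient may vanish, so the one below it decides. Its Pochhammer factors
  \<open>1 - b n + k\<close> with \<open>k < n - 1\<close> are all negative.\<close>

lemma degree_hyp_rodrigues:
  assumes "a \<ge> 1" "b \<ge> 1" "n \<ge> 1"
  shows "n - 1 \<le> degree (hyp_rodrigues n a b)"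
proof (rule le_degree)
  have 1: "n choose (n - 1) = n" "n - (n - 1) = 1" using assms binomial_symmetric[of "n - 1" n] by auto
  have 2: "a * real n - real n + real (n - 1) + 1 = a * real n" using assms by (simp add: of_nat_diff)
  have 3: "(1 - b) * real n + 1 - real n = 1 - b * real n" by (simp add: algebra_simps)
  have "pochhammer (1 - b * real n) (n - 1) \<noteq> 0"
  proof
    assume "pochhammer (1 - b * real n) (n - 1) = 0"
    then obtain k where "k < n - 1" "1 - b * real n = - real k" by (auto simp: pochhammer_eq_0_iff)
    moreover have "real n \<le> b * real n" using assms by simp
    ultimately show False by linarith
  qed
  then have "rodrigues_coeff (a * real n) ((1 - b) * real n) n (n - 1) \<noteq> 0"
    using assms unfolding rodrigues_coeff_def 1 2 3 by simp
  then show "coeff (hyp_rodrigues n a b) (n - 1) \<noteq> 0"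
    by (simp add: coeff_rodrigues_poly)
qed

text \<open>The Riccati equation of the logarithmic derivative. Its derivative term is the sum of the
  \<open>1 / (w - \<lambda>)\<^sup>2\<close>, which for negative \<open>w\<close> is one order smaller than the square of the sum of the
  \<open>1 / (w - \<lambda>)\<close>.\<close>

lemma hyp_poly_Riccati:
  assumes "a \<ge> 1" "b \<ge> 1" "n \<ge> 2" and w: "w < 0"
  defines "x \<equiv> real (size (proots (hyp_poly n a b))) / real n *
    (1 + Psi_transform (root_distribution (hyp_poly n a b)) (1 / w))"
  shows "nonneg_distribution (root_distribution (hyp_poly n a b))"
    and "n - 1 \<le> size (proots (hyp_poly n a b))" "size (proots (hyp_poly n a b)) \<le> n"
    and "0 \<le> x" "x \<le> 1"
    and "\<bar>beta_quad a b w x\<bar> \<le> (\<bar>1 + w\<bar> + 1 + 3 * \<bar>w\<bar>) / real n"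
proof -
  define R where "R = hyp_rodrigues n a b"
  obtain C where C: "C \<noteq> 0" "hyp_poly n a b = smult C R"
    using hyp_poly_eq[of a b n] assms by (auto simp: R_def)
  define X where "X = proots R"
  have X: "proots (hyp_poly n a b) = X" using C by (simp add: X_def)
  have "n \<ge> 1" using assms by simp
  have size: "size X = degree R" by (simp add: X_def size_proots_complex)
  show m1: "n - 1 \<le> size (proots (hyp_poly n a b))"
    unfolding X size R_def using degree_hyp_rodrigues[OF assms(1,2) \<open>n \<ge> 1\<close>] .
  show m2: "size (proots (hyp_poly n a b)) \<le> n"
    unfolding X size R_def by (rule degree_rodrigues_poly_le)
  have ne: "X \<noteq> {#}" using m1 assms unfolding X by auto
  have R0: "R \<noteq> 0" using ne by (auto simp: X_def)
  have roots: "z \<in> complex_of_real ` {0<..}" if "poly R z = 0" for z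
    using hyp_poly_roots[OF assms(1,2) \<open>n \<ge> 1\<close>, of z] that C by simp
  have roots_X: "0 < Re z" "z = complex_of_real (Re z)" if "z \<in># X" for z
    using roots[of z] that R0 by (auto simp: X_def)
  show nonneg: "nonneg_distribution (root_distribution (hyp_poly n a b))"
    using ne roots_X by (intro nonneg_distribution_root_distribution) (auto simp: X less_imp_le)
  define L M where "L = (\<Sum>z\<in>#X. 1 / (w - Re z))" and "M = (\<Sum>z\<in>#X. 1 / (w - Re z)\<^sup>2)"
  have n: "real n > 0" using assms by simp
  \<comment> \<open>The ratio of the number of roots to \<open>n\<close> in \<open>x\<close> undoes
    the normalization of the root distribution, so the identity is exact also when there are only
    \<open>n - 1\<close> roots.\<close>
  have xL: "real n * x = w * L"
  proof -
    have "1 + Psi_transform (root_distribution (hyp_poly n a b)) (1 / w) =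
        (\<Sum>z\<in>#X. 1 / (1 - Re z * (1 / w))) / real (size X)"
      using integral_root_distribution[of "hyp_poly n a b" "\<lambda>t. 1 / (1 - t * (1 / w))"] ne w
      by (subst one_plus_Psi[OF nonneg]) (simp_all add: X)
    then have "real n * x = (\<Sum>z\<in>#X. 1 / (1 - Re z * (1 / w)))"
      using ne n unfolding x_def X by simp
    also have "\<dots> = (\<Sum>z\<in>#X. w * (1 / (w - Re z)))"
    proof (intro arg_cong[of _ _ sum_mset] image_mset_cong)
      fix z assume "z \<in># X"
      then have "w - Re z < 0" using roots_X(1)[of z] w by linarith
      moreover have "1 - Re z * (1 / w) = (w - Re z) / w" using w by (simp add: diff_divide_distrib)
      ultimately show "1 / (1 - Re z * (1 / w)) = w * (1 / (w - Re z))" using w by simp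
    qed
    finally show ?thesis unfolding L_def sum_mset_distrib_left .
  qed
  have wL: "0 \<le> w * L" "w * L \<le> real (size X)"
  proof -
    have "0 \<le> w * (1 / (w - Re z))" "w * (1 / (w - Re z)) \<le> 1" if "z \<in># X" for z
    proof -
      have "w - Re z < 0" using roots_X(1)[OF that] w by linarith
      then show "0 \<le> w * (1 / (w - Re z))" "w * (1 / (w - Re z)) \<le> 1"
        using w roots_X(1)[OF that] by (simp_all add: zero_le_divide_iff divide_le_eq_1_neg)
    qed
    then show "0 \<le> w * L" "w * L \<le> real (size X)"
      unfolding L_def sum_mset_distrib_left by (auto intro!: sum_mset_bounds)
  qed
  have wM: "0 \<le> w\<^sup>2 * M" "w\<^sup>2 * M \<le> real (size X)"
  proof -
    have "w\<^sup>2 / (w - Re z)\<^sup>2 \<le> 1" if "z \<in># X" for z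
    proof -
      have "\<bar>w\<bar> \<le> \<bar>w - Re z\<bar>" using roots_X(1)[OF that] w by linarith
      then show ?thesis by (simp add: divide_le_eq_1 abs_le_square_iff)
    qed
    then show "0 \<le> w\<^sup>2 * M" "w\<^sup>2 * M \<le> real (size X)"
      unfolding M_def sum_mset_distrib_left by (auto intro!: sum_mset_bounds)
  qed
  have sizen: "real (size X) \<le> real n" using m2 X by simp
  show x0: "0 \<le> x" using xL wL(1) n by (simp flip: xL add: zero_le_mult_iff)
  show x1: "x \<le> 1"
  proof -
    have "real n * x \<le> real n * 1" using xL wL sizen by simp
    then show ?thesis using n by simp
  qed
  have Pw: "poly R (of_real w) \<noteq> 0"
  proof
    assume "poly R (of_real w) = 0"
    from roots[OF this] w show False by auto
  qed
  have conv: "(\<Sum>z\<in>#X. 1 / (complex_of_real w - z)) = of_real L"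
    "(\<Sum>z\<in>#X. 1 / (complex_of_real w - z)\<^sup>2) = of_real M"
  proof -
    have "1 / (complex_of_real w - z) = of_real (1 / (w - Re z))"
      "1 / (complex_of_real w - z)\<^sup>2 = of_real (1 / (w - Re z)\<^sup>2)" if "z \<in># X" for z
    proof -
      define r where "r = Re z"
      have "z = of_real r" using roots_X(2)[OF that] by (simp add: r_def)
      then show "1 / (complex_of_real w - z) = of_real (1 / (w - Re z))"
        "1 / (complex_of_real w - z)\<^sup>2 = of_real (1 / (w - Re z)\<^sup>2)" by simp_all
    qed
    then show "(\<Sum>z\<in>#X. 1 / (complex_of_real w - z)) = of_real L"
      "(\<Sum>z\<in>#X. 1 / (complex_of_real w - z)\<^sup>2) = of_real M"
      unfolding L_def M_def of_real_sum_mset by (auto intro!: arg_cong[of _ _ sum_mset] image_mset_cong)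
  qed
  have "of_real (w * (1 + w)) * poly (pderiv (pderiv R)) (of_real w) +
      of_real (a * real n - real n + 1 + ((1 - b) * real n + 2 - 2 * real n) * w) * poly (pderiv R) (of_real w) -
      of_real (real n * ((1 - b) * real n + 1 - real n)) * poly R (of_real w) = 0"
    using arg_cong[OF rodrigues_poly_ode[of "a * real n" "(1 - b) * real n" n], of "\<lambda>p. poly p (of_real w)"]
    unfolding R_def[symmetric] by (simp add: algebra_simps)
  then have "poly R (of_real w) * of_real (w * (1 + w) * (L\<^sup>2 - M) +
      (a * real n - real n + 1 + ((1 - b) * real n + 2 - 2 * real n) * w) * L -
      real n * ((1 - b) * real n + 1 - real n)) = 0"
    unfolding poly_pderiv_proots[OF Pw] poly_pderiv2_proots[OF Pw] X_def[symmetric] conv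
    by (simp add: algebra_simps)
  then have "w * (1 + w) * (L\<^sup>2 - M) +
      (a * real n - real n + 1 + ((1 - b) * real n + 2 - 2 * real n) * w) * L -
      real n * ((1 - b) * real n + 1 - real n) = 0"
    using Pw by (simp only: mult_eq_0_iff of_real_eq_0_iff) simp
  \<comment> \<open>The extra factor \<open>w\<close> makes \<open>w * L\<close> the unknown, which
    lies between 0 and the number of roots.\<close>
  then have "w * (w * (1 + w) * (L\<^sup>2 - M) +
      (a * real n - real n + 1 + ((1 - b) * real n + 2 - 2 * real n) * w) * L -
      real n * ((1 - b) * real n + 1 - real n)) = 0" by simp
  moreover have "w * (w * (1 + w) * (L\<^sup>2 - M) + c * L - d) = (1 + w) * ((w * L)\<^sup>2 - w\<^sup>2 * M) + c * (w * L) - d * w" for c d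
    by (simp add: algebra_simps power2_eq_square)
  ultimately have "(1 + w) * ((real n * x)\<^sup>2 - w\<^sup>2 * M) +
      (a * real n - real n + 1 + ((1 - b) * real n + 2 - 2 * real n) * w) * (real n * x) -
      real n * ((1 - b) * real n + 1 - real n) * w = 0"
    unfolding xL by (simp only:)
  \<comment> \<open>The terms of order \<open>n\<^sup>2\<close> form \<open>beta_quad\<close>; what
    is left on the right is O(n) for fixed \<open>w\<close>.\<close>
  then have key: "(real n)\<^sup>2 * beta_quad a b w x =
      (1 + w) * (w\<^sup>2 * M) - real n * x - 2 * real n * (w * x) + real n * w"
    unfolding beta_quad_def by (simp add: algebra_simps power2_eq_square)
  have "\<bar>(1 + w) * (w\<^sup>2 * M)\<bar> \<le> \<bar>1 + w\<bar> * real n"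
    unfolding abs_mult using wM sizen by (intro mult_left_mono) auto
  moreover have "\<bar>real n * x\<bar> \<le> real n" using x0 x1 n by (simp add: abs_mult mult_left_le)
  moreover have "\<bar>2 * real n * (w * x)\<bar> \<le> 2 * real n * \<bar>w\<bar>"
    unfolding abs_mult using x0 x1 n by (auto simp: mult_left_le)
  moreover have "\<bar>real n * w\<bar> = real n * \<bar>w\<bar>" using n by (simp add: abs_mult)
  ultimately have "\<bar>(real n)\<^sup>2 * beta_quad a b w x\<bar> \<le> \<bar>1 + w\<bar> * real n + real n + 2 * real n * \<bar>w\<bar> + real n * \<bar>w\<bar>"
    unfolding key by linarith
  also have "\<dots> = real n * (\<bar>1 + w\<bar> + 1 + 3 * \<bar>w\<bar>)" by (simp add: algebra_simps)
  finally have "real n * (real n * \<bar>beta_quad a b w x\<bar>) \<le> real n * (\<bar>1 + w\<bar> + 1 + 3 * \<bar>w\<bar>)"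
    by (simp add: abs_mult power2_eq_square mult.assoc)
  then show "\<bar>beta_quad a b w x\<bar> \<le> (\<bar>1 + w\<bar> + 1 + 3 * \<bar>w\<bar>) / real n"
    using n by (simp add: pos_le_divide_eq mult.commute)
qed


section \<open>The free beta prime distribution\<close>

lemma beta_quad_root_exists:
  assumes "a > 0" "b > 0" "w < 0"
  shows "\<exists>x. 0 < x \<and> x < 1 \<and> beta_quad a b w x = 0"
proof -
  have 0: "beta_quad a b w 0 < 0" using assms by (simp add: beta_quad_def mult_pos_neg)
  have 1: "beta_quad a b w 1 = a" by (simp add: beta_quad_def algebra_simps)
  have "continuous_on {0..1} (beta_quad a b w)"
    unfolding beta_quad_def by (intro continuous_intros)
  then obtain x where x: "0 \<le> x" "x \<le> 1" "beta_quad a b w x = 0"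
    using IVT'[of "beta_quad a b w" 0 0 1] 0 1 assms by auto
  then have "x \<noteq> 0" "x \<noteq> 1" using 0 1 assms by auto
  with x show ?thesis by (intro exI[of _ x]) auto
qed

definition beta_root :: "real \<Rightarrow> real \<Rightarrow> real \<Rightarrow> real" where
  "beta_root a b w = (SOME x. 0 < x \<and> x < 1 \<and> beta_quad a b w x = 0)"

lemma beta_root:
  assumes "a > 0" "b > 0" "w < 0"
  shows "0 < beta_root a b w" "beta_root a b w < 1" "beta_quad a b w (beta_root a b w) = 0"
  using someI_ex[OF beta_quad_root_exists[OF assms]] by (auto simp: beta_root_def)

text \<open>Approximate zeros lie near the exact one. Taking out the root leaves an affine cofactor,
  positive at 0 and at 1 because \<open>beta_quad\<close> has opposite signs there, hence bounded
  below between them.\<close>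

lemma beta_quad_stable:
  assumes "a > 0" "b > 0" "w < 0"
  obtains c where "c > 0" "\<And>x. 0 \<le> x \<Longrightarrow> x \<le> 1 \<Longrightarrow> c * \<bar>x - beta_root a b w\<bar> \<le> \<bar>beta_quad a b w x\<bar>"
proof -
  define r where "r = beta_root a b w"
  note r = beta_root[OF assms, folded r_def]
  define l where "l x = (1 + w) * (x + r) + (a - 1 - (1 + b) * w)" for x
  have fac: "beta_quad a b w x = (x - r) * l x" for x
  proof -
    have "beta_quad a b w x = beta_quad a b w x - beta_quad a b w r" using r by simp
    also have "\<dots> = (x - r) * l x" by (simp add: beta_quad_def l_def algebra_simps power2_eq_square)
    finally show ?thesis .
  qed
  have "b * w < 0" using assms by (simp add: mult_pos_neg)
  then have "0 < r * l 0" using fac[of 0] by (simp add: beta_quad_def)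
  then have l0: "l 0 > 0" using r by (simp add: zero_less_mult_iff)
  have "(1 - r) * l 1 > 0" using fac[of 1] assms by (simp add: beta_quad_def algebra_simps)
  then have l1: "l 1 > 0" using r by (simp add: zero_less_mult_iff)
  define c where "c = min (l 0) (l 1)"
  have c: "c > 0" using l0 l1 by (simp add: c_def)
  have "c * \<bar>x - r\<bar> \<le> \<bar>beta_quad a b w x\<bar>" if x: "0 \<le> x" "x \<le> 1" for x
  proof -
    have "l x = (1 - x) * l 0 + x * l 1" by (simp add: l_def algebra_simps)
    moreover have "(1 - x) * c \<le> (1 - x) * l 0" "x * c \<le> x * l 1"
      using x by (auto intro!: mult_left_mono simp: c_def)
    moreover have "(1 - x) * c + x * c = c" by (simp add: algebra_simps)
    ultimately have "c \<le> l x" by linarith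
    then have "c * \<bar>x - r\<bar> \<le> \<bar>l x\<bar> * \<bar>x - r\<bar>" by (intro mult_right_mono) auto
    then show ?thesis by (simp add: fac abs_mult mult.commute)
  qed
  with c show ?thesis by (intro that) (auto simp: r_def)
qed

lemma beta_root_unique:
  assumes "a > 0" "b > 0" "w < 0" "0 \<le> x" "x \<le> 1" "beta_quad a b w x = 0"
  shows "x = beta_root a b w"
proof -
  obtain c where "c > 0" "c * \<bar>x - beta_root a b w\<bar> \<le> \<bar>beta_quad a b w x\<bar>"
    using beta_quad_stable[OF assms(1-3)] assms(4,5) by metis
  then show ?thesis using assms(6) by (simp add: mult_le_0_iff)
qed

text \<open>The quadratic is the S-transform equation
  \<open>(1 + u) / u * z = (b - 1 - u) / (a + u)\<close> with denominators cleared.\<close>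

lemma beta_quad_times:
  "z \<noteq> 0 \<Longrightarrow> z * beta_quad a b (1 / z) (1 + u) = z * (1 + u) * (a + u) - u * (b - 1 - u)"
  by (simp add: beta_quad_def field_simps power2_eq_square)

lemma beta_root_at_left_0:
  assumes "a > 0" "b \<ge> 1"
  shows "((\<lambda>z. beta_root a b (1 / z) - 1) \<longlongrightarrow> 0) (at_left 0)"
proof (rule Lim_null_comparison)
  have "norm (beta_root a b (1 / z) - 1) \<le> sqrt (\<bar>z\<bar> * (1 + a))" if z: "z < 0" for z
  proof -
    define u where "u = beta_root a b (1 / z) - 1"
    have "1 / z < 0" using z by simp
    then have u: "-1 < u" "u < 0" "beta_quad a b (1 / z) (1 + u) = 0"
      using beta_root[of a b "1 / z"] assms by (auto simp: u_def)
    have "z * (1 + u) * (a + u) = u * (b - 1 - u)"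
      using beta_quad_times[of z a b u] u z by simp
    moreover have "u * (b - 1) \<le> 0" using u assms by (simp add: mult_nonpos_nonneg)
    ultimately have "u\<^sup>2 \<le> \<bar>z\<bar> * ((1 + u) * (a + u))"
      using z by (simp add: algebra_simps power2_eq_square)
    also have "(1 + u) * (a + u) \<le> 1 + a"
    proof -
      have "(1 + u) * (a + u) \<le> (1 + u) * (1 + a)" using u by (intro mult_left_mono) auto
      also have "\<dots> \<le> 1 * (1 + a)" using u assms by (intro mult_right_mono) auto
      finally show ?thesis by simp
    qed
    then have "\<bar>z\<bar> * ((1 + u) * (a + u)) \<le> \<bar>z\<bar> * (1 + a)" by (intro mult_left_mono) auto
    finally have "sqrt (u\<^sup>2) \<le> sqrt (\<bar>z\<bar> * (1 + a))" by (rule real_sqrt_le_mono)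
    then show ?thesis by (simp add: u_def)
  qed
  then show "eventually (\<lambda>z. norm (beta_root a b (1 / z) - 1) \<le> sqrt (\<bar>z\<bar> * (1 + a))) (at_left 0)"
    by (auto simp: eventually_at_left_field intro!: exI[of _ "-1"])
  have "((\<lambda>z. sqrt (\<bar>z\<bar> * (1 + a))) \<longlongrightarrow> sqrt (\<bar>0\<bar> * (1 + a))) (at_left 0)"
    by (intro tendsto_intros)
  then show "((\<lambda>z. sqrt (\<bar>z\<bar> * (1 + a))) \<longlongrightarrow> 0) (at_left 0)" by simp
qed

text \<open>The shift by 2 leaves out degenerate degrees: for \<open>n = 1\<close> and
  \<open>b = 1\<close> there is no root. Stability turns the O(1/n) residual into an O(1/n)
  distance, and replacing the number of roots by \<open>n\<close> costs at most another
  \<open>1 / n\<close>.\<close>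

lemma tendsto_Psi_hyp_poly:
  assumes ab: "a \<ge> 1" "b \<ge> 1" and z: "z < 0"
  shows "(\<lambda>n. Psi_transform (root_distribution (hyp_poly (n + 2) a b)) z) \<longlonglongrightarrow> beta_root a b (1 / z) - 1"
proof -
  define w where "w = 1 / z"
  have w: "w < 0" "1 / w = z" using z by (auto simp: w_def)
  define P where "P n = 1 + Psi_transform (root_distribution (hyp_poly (n + 2) a b)) z" for n
  define m where "m n = real (size (proots (hyp_poly (n + 2) a b))) / real (n + 2)" for n
  define K where "K = \<bar>1 + w\<bar> + 1 + 3 * \<bar>w\<bar>"
  have two: "n + 2 \<ge> 2" for n :: nat by simp
  note est = hyp_poly_Riccati[OF ab two w(1), unfolded w(2), folded m_def P_def K_def]
  obtain c where c: "c > 0" "\<And>x. 0 \<le> x \<Longrightarrow> x \<le> 1 \<Longrightarrow> c * \<bar>x - beta_root a b w\<bar> \<le> \<bar>beta_quad a b w x\<bar>"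
    using beta_quad_stable[of a b w] ab w by (metis less_le_trans zero_less_one)
  have 1: "(\<lambda>n. m n * P n - beta_root a b w) \<longlonglongrightarrow> 0"
  proof (rule Lim_null_comparison)
    have "norm (m n * P n - beta_root a b w) \<le> K / real (n + 2) / c" for n
    proof -
      have "c * \<bar>m n * P n - beta_root a b w\<bar> \<le> K / real (n + 2)"
        using c(2)[OF est(4)[of n] est(5)[of n]] est(6)[of n] by simp
      then have "\<bar>m n * P n - beta_root a b w\<bar> \<le> K / real (n + 2) / c"
        unfolding pos_le_divide_eq[OF c(1)] by (simp only: mult.commute)
      then show ?thesis by simp
    qed
    then show "eventually (\<lambda>n. norm (m n * P n - beta_root a b w) \<le> K / real (n + 2) / c) sequentially" by simp
    show "(\<lambda>n. K / real (n + 2) / c) \<longlonglongrightarrow> 0" by (rule tendsto_divide_zero) real_asymp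
  qed
  have 2: "(\<lambda>n. P n - m n * P n) \<longlonglongrightarrow> 0"
  proof (rule Lim_null_comparison)
    have "norm (P n - m n * P n) \<le> 1 / real (n + 2)" for n
    proof -
      have P: "0 \<le> P n" "P n \<le> 1"
        unfolding P_def using one_plus_Psi_ge[OF est(1)[of n] z] Psi_nonpos[OF est(1)[of n] z]
          measure_nonneg[of "root_distribution (hyp_poly (n + 2) a b)" "{0}"] by linarith+
      have m: "0 \<le> 1 - m n" "1 - m n \<le> 1 / real (n + 2)"
      proof -
        define s where "s = size (proots (hyp_poly (n + 2) a b))"
        have "n + 1 \<le> s" "s \<le> n + 2" using est(2,3)[of n] by (simp_all add: s_def)
        then have s: "0 \<le> real (n + 2) - real s" "real (n + 2) - real s \<le> 1" by linarith+
        have "1 - m n = (real (n + 2) - real s) / real (n + 2)"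
          unfolding m_def s_def[symmetric] by (simp add: diff_divide_distrib)
        with s show "0 \<le> 1 - m n" "1 - m n \<le> 1 / real (n + 2)"
          by (simp_all only: divide_nonneg_nonneg of_nat_0_le_iff divide_right_mono)
      qed
      have "P n - m n * P n = (1 - m n) * P n" by (simp add: algebra_simps)
      then have "norm (P n - m n * P n) = (1 - m n) * P n" using P m by (simp add: abs_mult)
      also have "\<dots> \<le> (1 - m n) * 1" using P m by (intro mult_left_mono)
      finally show ?thesis using m by simp
    qed
    then show "eventually (\<lambda>n. norm (P n - m n * P n) \<le> 1 / real (n + 2)) sequentially" by simp
    show "(\<lambda>n. 1 / real (n + 2)) \<longlonglongrightarrow> 0" by real_asymp
  qed
  have "(\<lambda>n. (m n * P n - beta_root a b w) + (P n - m n * P n) + (beta_root a b w - 1)) \<longlonglongrightarrow> 0 + 0 + (beta_root a b w - 1)"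
    by (intro tendsto_add 1 2 tendsto_const)
  then show ?thesis by (simp add: P_def w_def)
qed

lemma hyp_poly_limit:
  assumes "a \<ge> 1" "b \<ge> 1"
  obtains \<nu> where "nonneg_distribution \<nu>" "\<And>z. z < 0 \<Longrightarrow> Psi_transform \<nu> z = beta_root a b (1 / z) - 1"
    "weak_conv_m (\<lambda>n. root_distribution (hyp_poly n a b)) \<nu>"
proof -
  have "nonneg_distribution (root_distribution (hyp_poly (n + 2) a b))" for n
    using hyp_poly_Riccati(1)[of a b "n + 2" "-1"] assms by simp
  then obtain \<nu> where \<nu>: "nonneg_distribution \<nu>" "\<And>z. z < 0 \<Longrightarrow> Psi_transform \<nu> z = beta_root a b (1 / z) - 1"
    and conv: "weak_conv_m (\<lambda>n. root_distribution (hyp_poly (n + 2) a b)) \<nu>"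
    using Psi_transform_continuity[OF _ tendsto_Psi_hyp_poly[OF assms] beta_root_at_left_0[of a b]] assms by auto
  have "weak_conv_m (\<lambda>n. root_distribution (hyp_poly n a b)) \<nu>"
    unfolding weak_conv_m_def weak_conv_def
  proof (intro allI impI)
    fix x assume "isCont (cdf \<nu>) x"
    then have "(\<lambda>n. cdf (root_distribution (hyp_poly (n + 2) a b)) x) \<longlonglongrightarrow> cdf \<nu> x"
      using conv by (simp add: weak_conv_m_def weak_conv_def)
    then show "(\<lambda>n. cdf (root_distribution (hyp_poly n a b)) x) \<longlonglongrightarrow> cdf \<nu> x"
      by (rule LIMSEQ_offset)
  qed
  with \<nu> show ?thesis by (rule that)
qed

section \<open>From \<Psi> to the S-transform\<close>

lemma S_transform_Psi:
  assumes "nonneg_distribution \<mu>" "measure \<mu> {0} < 1" "z < 0"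
  shows "S_transform \<mu> (Psi_transform \<mu> z) = (1 + Psi_transform \<mu> z) / Psi_transform \<mu> z * z"
  unfolding S_transform_def using the_inv_into_f_f[OF inj_on_Psi_transform[OF assms(1,2)], of z] assms(3) by simp

text \<open>The definite description prescribes the S-transform, the limit theorem supplies
  \<open>\<Psi>\<close>; existence and uniqueness both pass through this equivalence. The condition
  on \<open>S_domain\<close> says that there is no atom at 0.\<close>

lemma beta_prime_iff:
  assumes ab: "a \<ge> 1" "b \<ge> 1" and \<mu>: "nonneg_distribution \<mu>"
  shows "(S_domain \<mu> = {-1<..<0} \<and> (\<forall>v\<in>S_domain \<mu>. S_transform \<mu> v = (b - 1 - v) / (a + v))) \<longleftrightarrow>
    (\<forall>z<0. Psi_transform \<mu> z = beta_root a b (1 / z) - 1)" (is "?L \<longleftrightarrow> ?R")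
proof
  interpret real_distribution \<mu> using nonneg_distributionD[OF \<mu>] by simp
  { assume L: ?L
    have m0: "measure \<mu> {0} = 0"
    proof (rule ccontr)
      assume "measure \<mu> {0} \<noteq> 0"
      then have "measure \<mu> {0} > 0" using measure_nonneg[of \<mu> "{0}"] by linarith
      moreover have "measure \<mu> {0} \<le> 1" by (rule prob_le_1)
      ultimately have "-1 + measure \<mu> {0} / 2 \<in> {-1<..<0}"
        unfolding greaterThanLessThan_iff by linarith
      then have "-1 + measure \<mu> {0} / 2 \<in> S_domain \<mu>" using L by (simp only:)
      then show False using \<open>measure \<mu> {0} > 0\<close> by (simp add: S_domain_def)
    qed
    show ?R
    proof (intro allI impI)
      fix z :: real assume z: "z < 0"
      define v where "v = Psi_transform \<mu> z"
      have vS: "v \<in> S_domain \<mu>" unfolding v_def by (rule Psi_in_S_domain[OF \<mu> z]) (simp add: m0)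
      then have v: "-1 < v" "v < 0" using L by auto
      have "(1 + v) / v * z = (b - 1 - v) / (a + v)"
        using S_transform_Psi[OF \<mu> _ z] m0 L vS by (simp add: v_def)
      then have "z * (1 + v) * (a + v) - v * (b - 1 - v) = 0"
        using v ab by (simp add: field_simps)
      then have "beta_quad a b (1 / z) (1 + v) = 0"
        using beta_quad_times[of z a b v] z by simp
      then have "1 + v = beta_root a b (1 / z)"
        using v ab z by (intro beta_root_unique) auto
      then show "Psi_transform \<mu> z = beta_root a b (1 / z) - 1" by (simp add: v_def)
    qed }
  { assume R: ?R
    have Psi: "-1 < Psi_transform \<mu> z" "Psi_transform \<mu> z < 0"
      "z * (1 + Psi_transform \<mu> z) * (a + Psi_transform \<mu> z) = Psi_transform \<mu> z * (b - 1 - Psi_transform \<mu> z)"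
      if z: "z < 0" for z
    proof -
      have "1 / z < 0" using z by simp
      note * = beta_root[of a b "1 / z", OF _ _ this] R[rule_format, OF z]
      show "-1 < Psi_transform \<mu> z" "Psi_transform \<mu> z < 0" using * ab by auto
      have "beta_quad a b (1 / z) (1 + Psi_transform \<mu> z) = 0" using * ab by simp
      then show "z * (1 + Psi_transform \<mu> z) * (a + Psi_transform \<mu> z) = Psi_transform \<mu> z * (b - 1 - Psi_transform \<mu> z)"
        using beta_quad_times[of z a b "Psi_transform \<mu> z"] z by simp
    qed
    have m0: "measure \<mu> {0} = 0"
    proof (rule ccontr)
      define m where "m = measure \<mu> {0}"
      assume "measure \<mu> {0} \<noteq> 0"
      then have m: "m > 0" unfolding m_def using measure_nonneg[of \<mu> "{0}"] by linarith
      \<comment> \<open>An atom \<open>m\<close> bounds \<open>1 + u\<close> and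
        \<open>a + u\<close> from below, so one side of the cleared equation grows with
        \<open>- z\<close>, while the other has absolute value at most \<open>b\<close>. This
        \<open>z\<close> pushes the former to at least \<open>b + 1\<close>.\<close>
      define z where "z = - ((b + 1) / m\<^sup>2)"
      have z: "z < 0" using m ab by (simp add: z_def)
      define u where "u = Psi_transform \<mu> z"
      note u = Psi[OF z, folded u_def]
      have "m \<le> 1 + u" using one_plus_Psi_ge[OF \<mu> z] by (simp add: m_def u_def)
      then have "m * m \<le> (1 + u) * (a + u)" using m ab u by (intro mult_mono) auto
      then have "- z * (m * m) \<le> - z * ((1 + u) * (a + u))" using z by (intro mult_left_mono) auto
      also have "\<dots> = (- u) * (b - 1 - u)" using u(3) by (simp add: algebra_simps)
      also have "\<dots> \<le> 1 * b" using u ab by (intro mult_mono) auto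
      finally have "- z * (m * m) \<le> b" by simp
      moreover have "- z * (m * m) = b + 1" using m by (simp add: z_def power2_eq_square)
      ultimately show False by simp
    qed
    have dom: "S_domain \<mu> = {-1<..<0}" by (simp add: S_domain_def m0)
    moreover have "S_transform \<mu> v = (b - 1 - v) / (a + v)" if v: "-1 < v" "v < 0" for v
    proof -
      \<comment> \<open>The point where \<open>\<Psi>\<close> takes the value \<open>v\<close>,
        found by solving the cleared equation for \<open>z\<close>.\<close>
      define z where "z = v * (b - 1 - v) / ((1 + v) * (a + v))"
      have pos: "0 < (1 + v) * (a + v)" using v ab by (intro mult_pos_pos) auto
      have "v * (b - 1 - v) < 0" using v ab by (intro mult_neg_pos) auto
      then have z: "z < 0" using pos by (simp add: z_def divide_neg_pos)
      have nz: "1 + v \<noteq> 0" "a + v \<noteq> 0" using v ab by auto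
      then have "z * (1 + v) * (a + v) = v * (b - 1 - v)" by (simp add: z_def)
      then have "beta_quad a b (1 / z) (1 + v) = 0"
        using beta_quad_times[of z a b v] z by simp
      then have "1 + v = beta_root a b (1 / z)"
        using v ab z by (intro beta_root_unique) auto
      then have "Psi_transform \<mu> z = v" using R z by simp
      then have "S_transform \<mu> v = (1 + v) / v * z"
        using S_transform_Psi[OF \<mu> _ z] m0 by simp
      also have "\<dots> = (b - 1 - v) / (a + v)" using v nz by (simp add: z_def)
      finally show ?thesis .
    qed
    ultimately show ?L by simp }
qed

text \<open>The law arises as the limit of the root distributions, so existence and weak convergence
  come together; uniqueness is that of \<open>\<Psi>\<close>.\<close>

lemma
  assumes ab: "a \<ge> 1" "b \<ge> 1"
  shows nonneg_free_beta_prime: "nonneg_distribution (free_beta_prime a b)"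
    and Psi_free_beta_prime: "z < 0 \<Longrightarrow> Psi_transform (free_beta_prime a b) z = beta_root a b (1 / z) - 1"
    and weak_conv_free_beta_prime: "weak_conv_m (\<lambda>n. root_distribution (hyp_poly n a b)) (free_beta_prime a b)"
proof -
  obtain \<nu> where \<nu>: "nonneg_distribution \<nu>" "\<And>z. z < 0 \<Longrightarrow> Psi_transform \<nu> z = beta_root a b (1 / z) - 1"
    "weak_conv_m (\<lambda>n. root_distribution (hyp_poly n a b)) \<nu>"
    using hyp_poly_limit[OF ab] by blast
  have min: "min a 1 = 1" using ab by simp
  have "free_beta_prime a b = \<nu>"
    unfolding free_beta_prime_def min
  proof (rule the_equality)
    show "nonneg_distribution \<nu> \<and> S_domain \<nu> = {- 1<..<0} \<and>
        (\<forall>z\<in>S_domain \<nu>. S_transform \<nu> z = (b - 1 - z) / (a + z))"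
      using \<nu> beta_prime_iff[OF ab \<nu>(1)] by blast
    fix \<rho> assume \<rho>: "nonneg_distribution \<rho> \<and> S_domain \<rho> = {- 1<..<0} \<and>
        (\<forall>z\<in>S_domain \<rho>. S_transform \<rho> z = (b - 1 - z) / (a + z))"
    then have "\<forall>z<0. Psi_transform \<rho> z = beta_root a b (1 / z) - 1"
      using beta_prime_iff[OF ab, of \<rho>] by blast
    then show "\<rho> = \<nu>" using \<nu> \<rho> by (intro Psi_transform_unique) auto
  qed
  with \<nu> show "nonneg_distribution (free_beta_prime a b)"
    "z < 0 \<Longrightarrow> Psi_transform (free_beta_prime a b) z = beta_root a b (1 / z) - 1"
    "weak_conv_m (\<lambda>n. root_distribution (hyp_poly n a b)) (free_beta_prime a b)"
    by auto
qed

lemma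
  assumes "a \<ge> 1" "b \<ge> 1"
  shows S_domain_free_beta_prime: "S_domain (free_beta_prime a b) = {-1<..<0}"
    and S_transform_free_beta_prime: "-1 < v \<Longrightarrow> v < 0 \<Longrightarrow> S_transform (free_beta_prime a b) v = (b - 1 - v) / (a + v)"
  using beta_prime_iff[OF assms nonneg_free_beta_prime[OF assms]] Psi_free_beta_prime[OF assms] by auto

lemma
  assumes ab: "a \<ge> 1" "b \<ge> 1"
  defines "\<tau> \<equiv> distr (free_beta_prime a b) borel (\<lambda>t. t + 1)"
  shows S_domain_shifted_free_beta_prime: "S_domain \<tau> = {-1<..<0}"
    and S_transform_shifted_free_beta_prime:
      "-1 < v \<Longrightarrow> v < 0 \<Longrightarrow> S_transform \<tau> v = (b - 1 - v) / (a + b - 1 - v)"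
proof -
  define \<mu> where "\<mu> = free_beta_prime a b"
  have \<mu>: "nonneg_distribution \<mu>" unfolding \<mu>_def by (rule nonneg_free_beta_prime[OF ab])
  have \<tau>: "\<tau> = distr \<mu> borel (\<lambda>t. t + 1)" by (simp add: \<tau>_def \<mu>_def)
  interpret real_distribution \<mu> using nonneg_distributionD[OF \<mu>] by simp
  have "prob_space \<tau>" unfolding \<tau> by (rule prob_space_distr) simp
  then have dist: "real_distribution \<tau>"
    by (simp add: real_distribution_def real_distribution_axioms_def \<tau>)
  have "AE t in \<tau>. 0 \<le> t"
    unfolding \<tau> using nonneg_distributionD(2)[OF \<mu>]
    by (subst AE_distr_iff) (auto elim!: eventually_mono)
  with dist have nonneg: "nonneg_distribution \<tau>" by (simp add: nonneg_distribution_def)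
  have "AE t in \<mu>. t \<notin> {-1}" using nonneg_distributionD(2)[OF \<mu>] by eventually_elim auto
  then have "measure \<mu> {-1} = 0" using prob_eq_0[of "{-1}"] by simp
  moreover have "measure \<tau> {0} = measure \<mu> {-1}"
    unfolding \<tau> by (subst measure_distr) (auto intro!: arg_cong[of _ _ "measure \<mu>"])
  ultimately have m0: "measure \<tau> {0} = 0" by simp
  show "S_domain \<tau> = {-1<..<0}" by (simp add: S_domain_def m0)
  have Psi: "1 + Psi_transform \<tau> z = (1 + Psi_transform \<mu> (z / (1 - z))) / (1 - z)" if z: "z < 0" for z
  proof -
    have "z / (1 - z) < 0" using z by (simp add: divide_neg_pos)
    note Psi\<mu> = one_plus_Psi[OF \<mu> this]
    have "1 + Psi_transform \<tau> z = (LINT t|\<mu>. 1 / (1 - (t + 1) * z))"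
      unfolding one_plus_Psi[OF nonneg z] unfolding \<tau> by (intro integral_distr) simp_all
    also have "\<dots> = (LINT t|\<mu>. 1 / (1 - t * (z / (1 - z))) / (1 - z))"
    proof (intro Bochner_Integration.integral_cong refl)
      fix t
      have "1 - t * (z / (1 - z)) = (1 - (t + 1) * z) / (1 - z)"
        using z by (simp add: field_simps)
      then show "1 / (1 - (t + 1) * z) = 1 / (1 - t * (z / (1 - z))) / (1 - z)" using z by simp
    qed
    also have "\<dots> = (1 + Psi_transform \<mu> (z / (1 - z))) / (1 - z)"
      unfolding Psi\<mu> by (rule integral_divide_zero)
    finally show ?thesis .
  qed
  assume v: "-1 < v" "v < 0"
  define D where "D = a + b - 1 - v"
  have D: "D > 0" using ab v by (simp add: D_def)
  \<comment> \<open>\<open>z\<close> is \<open>v / (1 + v)\<close> times the claimed value of the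
    S-transform. The translation rule \<open>1 + v = (1 + u) / (1 - z)\<close> then forces
    \<open>u\<close>, the value of \<open>\<Psi>\<close> of the untranslated law at
    \<open>\<zeta>\<close>.\<close>
  define u where "u = a * v / D"
  define z where "z = v * (b - 1 - v) / ((1 + v) * D)"
  define \<zeta> where "\<zeta> = z / (1 - z)"
  have bv: "b - 1 - v > 0" using ab v by simp
  have z: "z < 0" unfolding z_def using v D bv by (intro divide_neg_pos mult_neg_pos mult_pos_pos) auto
  have \<zeta>: "\<zeta> < 0" using z by (simp add: \<zeta>_def divide_neg_pos)
  have u: "u < 0" "-1 < u"
  proof -
    show "u < 0" unfolding u_def using v D ab by (intro divide_neg_pos mult_pos_neg) auto
    have "(a - 1) * (1 + v) \<ge> 0" using ab v by simp
    then have "- D < a * v" using ab by (simp add: D_def algebra_simps)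
    then show "-1 < u" using D by (simp add: u_def field_simps)
  qed
  have e1: "1 - z = (D + v * a) / ((1 + v) * D)"
  proof -
    have "1 - z = ((1 + v) * D - v * (b - 1 - v)) / ((1 + v) * D)"
      unfolding z_def using v D by (simp add: diff_divide_distrib)
    also have "(1 + v) * D - v * (b - 1 - v) = D + v * a" by (simp add: D_def algebra_simps)
    finally show ?thesis .
  qed
  have e2: "1 + u = (D + v * a) / D" using D by (simp add: u_def field_simps)
  have nz: "D + v * a \<noteq> 0" using u(2) D e2 by auto
  \<comment> \<open>The cleared equation of the untranslated law; as \<open>1 + u\<close> lies
    between 0 and 1, uniqueness of the zero identifies \<open>u\<close>.\<close>
  have rel: "\<zeta> * (1 + u) * (a + u) = u * (b - 1 - u)"
  proof -
    have e3: "a + u = a * (a + b - 1) / D" using D by (simp add: u_def D_def field_simps)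
    have e4: "b - 1 - u = (a + b - 1) * (b - 1 - v) / D" using D by (simp add: u_def D_def field_simps)
    have "\<zeta> = v * (b - 1 - v) / (D + v * a)"
      unfolding \<zeta>_def e1 unfolding z_def using v D by simp
    then have "\<zeta> * (1 + u) = v * (b - 1 - v) / D" unfolding e2 using nz D by simp
    then show ?thesis unfolding e3 e4 by (simp add: u_def)
  qed
  have "beta_quad a b (1 / \<zeta>) (1 + u) = 0"
    using beta_quad_times[of \<zeta> a b u] \<zeta> rel by simp
  then have "1 + u = beta_root a b (1 / \<zeta>)"
    using u ab \<zeta> by (intro beta_root_unique) auto
  then have Psiu: "Psi_transform \<mu> \<zeta> = u"
    using Psi_free_beta_prime[OF ab \<zeta>] by (simp add: \<mu>_def)
  have "1 + Psi_transform \<tau> z = (1 + u) / (1 - z)"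
    using Psi[OF z] Psiu by (simp add: \<zeta>_def)
  also have "\<dots> = 1 + v"
    unfolding e1 e2 using D v nz by simp
  finally have "Psi_transform \<tau> z = v" by simp
  then have "S_transform \<tau> v = (1 + v) / v * z"
    using S_transform_Psi[OF nonneg _ z] m0 by simp
  also have "\<dots> = (b - 1 - v) / D" using v D by (simp add: z_def)
  finally show "S_transform \<tau> v = (b - 1 - v) / (a + b - 1 - v)" by (simp add: D_def)
qed

text \<open>The factors \<open>a + b - 1 - v\<close> cancel, so the definite description of the
  convolution becomes that of \<open>free_beta_prime a b\<close>.\<close>

lemma free_mult_conv_free_beta_prime:
  assumes "a \<ge> 1" "b \<ge> 1"
  shows "free_mult_conv (free_beta_prime a (a + b)) (distr (free_beta_prime a b) borel (\<lambda>t. t + 1)) =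
    free_beta_prime a b"
proof -
  have ab: "a + b \<ge> 1" using assms by simp
  have min: "min a 1 = 1" using assms by simp
  have "(a + b - 1 - v) / (a + v) * ((b - 1 - v) / (a + b - 1 - v)) = (b - 1 - v) / (a + v)"
    if "-1 < v" "v < 0" for v
    using that assms by simp
  then have S: "S_transform (free_beta_prime a (a + b)) v * S_transform (distr (free_beta_prime a b) borel (\<lambda>t. t + 1)) v =
      (b - 1 - v) / (a + v)" if "v \<in> {-1<..<0}" for v
    using that assms ab by (simp add: S_transform_free_beta_prime S_transform_shifted_free_beta_prime)
  have "(nonneg_distribution \<rho> \<and> S_domain \<rho> = {-1<..<0} \<and>
      (\<forall>z\<in>S_domain \<rho>. S_transform \<rho> z = S_transform (free_beta_prime a (a + b)) z * S_transform (distr (free_beta_prime a b) borel (\<lambda>t. t + 1)) z)) \<longleftrightarrow>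
    (nonneg_distribution \<rho> \<and> S_domain \<rho> = {-1<..<0} \<and> (\<forall>z\<in>S_domain \<rho>. S_transform \<rho> z = (b - 1 - z) / (a + z)))" for \<rho>
    using S by auto
  then have "free_mult_conv (free_beta_prime a (a + b)) (distr (free_beta_prime a b) borel (\<lambda>t. t + 1)) =
      (THE \<rho>. nonneg_distribution \<rho> \<and> S_domain \<rho> = {-1<..<0} \<and> (\<forall>z\<in>S_domain \<rho>. S_transform \<rho> z = (b - 1 - z) / (a + z)))"
    unfolding free_mult_conv_def S_domain_free_beta_prime[OF assms(1) ab]
      S_domain_shifted_free_beta_prime[OF assms] Int_absorb by (simp only:)
  then show ?thesis by (simp only: free_beta_prime_def[of a b] min)
qed


section \<open>Voiculescu transforms and free additive convolution with a point mass\<close>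

lemma open_truncated_cone: "open (truncated_cone \<alpha> \<beta>)"
  unfolding truncated_cone_def by (intro open_Collect_conj open_Collect_less continuous_intros)

text \<open>Integral bound of \<open>\<bar>t / (z - t)\<bar>\<close> over the points \<open>z\<close> of the cone of aperture \<open>2\<close> above height \<open>R\<close>.\<close>

definition cone_tail :: "real measure \<Rightarrow> real \<Rightarrow> real" where
  "cone_tail \<mu> R = (LINT t|\<mu>. min 4 (\<bar>t\<bar> / \<bar>R\<bar>))"

context real_distribution
begin

lemma integrable_cone_tail: "integrable M (\<lambda>t. min 4 (\<bar>t\<bar> / \<bar>R\<bar>))"
  by (rule integrable_const_bound[where B = 4]) auto

lemma tendsto_cone_tail: "(cone_tail M \<longlongrightarrow> 0) at_top"
proof (rule tendsto_at_topI_sequentially)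
  fix X :: "nat \<Rightarrow> real" assume X: "filterlim X at_top sequentially"
  have "(\<lambda>n. LINT t|M. min 4 (\<bar>t\<bar> / \<bar>X n\<bar>)) \<longlonglongrightarrow> (LINT t|M. 0)"
  proof (rule bounded_convergence[where B = 4])
    show "norm (min 4 (\<bar>t\<bar> / \<bar>X n\<bar>)) \<le> 4" for n t by simp
    show "(\<lambda>n. min 4 (\<bar>t\<bar> / \<bar>X n\<bar>)) \<longlonglongrightarrow> 0" for t
    proof -
      have "filterlim (\<lambda>n. \<bar>X n\<bar>) at_top sequentially"
        by (rule filterlim_at_top_mono[OF X]) (intro always_eventually allI abs_ge_self)
      then have "(\<lambda>n. \<bar>t\<bar> / \<bar>X n\<bar>) \<longlonglongrightarrow> 0"
        by (rule real_tendsto_divide_at_top[OF tendsto_const])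
      then have "(\<lambda>n. min 4 (\<bar>t\<bar> / \<bar>X n\<bar>)) \<longlonglongrightarrow> min 4 0"
        by (intro tendsto_min tendsto_const)
      then show ?thesis by simp
    qed
  qed measurable
  then show "(\<lambda>n. cone_tail M (X n)) \<longlonglongrightarrow> 0" by (simp add: cone_tail_def)
qed

text \<open>In the cone \<open>norm z \<le> 3 * Im z \<le> 3 * norm (z - t)\<close>, hence
  \<open>norm t \<le> 4 * norm (z - t)\<close>. This cap permits bounded convergence without moments
  of the measure.\<close>

lemma resolvent_in_cone:
  assumes "z \<in> truncated_cone 2 R" "R > 0"
  shows "norm (complex_of_real t / (z - complex_of_real t)) \<le> min 4 (\<bar>t\<bar> / \<bar>R\<bar>)"
proof (rule min.boundedI)
  have z: "R < Im z" "\<bar>Re z\<bar> < 2 * Im z" using assms by (auto simp: truncated_cone_def)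
  have far: "Im z \<le> norm (z - complex_of_real t)" using Im_le_norm_resolvent[of z t] by linarith
  show "norm (complex_of_real t / (z - complex_of_real t)) \<le> \<bar>t\<bar> / \<bar>R\<bar>"
    using far z assms(2) by (auto simp: norm_divide intro!: divide_left_mono mult_pos_pos)
  have "norm z \<le> \<bar>Re z\<bar> + \<bar>Im z\<bar>" by (rule cmod_le)
  then have "norm z \<le> 3 * Im z" using z assms(2) by linarith
  then have "norm z \<le> 3 * norm (z - complex_of_real t)" using far by linarith
  moreover have "norm (complex_of_real t) \<le> norm z + norm (z - complex_of_real t)"
    using norm_triangle_ineq4[of z "z - complex_of_real t"] by simp
  ultimately have "norm (complex_of_real t) \<le> 4 * norm (z - complex_of_real t)" by linarith
  moreover have "norm (z - complex_of_real t) > 0" using far z assms(2) by linarith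
  ultimately show "norm (complex_of_real t / (z - complex_of_real t)) \<le> 4"
    by (simp add: norm_divide pos_divide_le_eq)
qed

text \<open>Both estimates rest on \<open>z / (z - t) = 1 + x\<close> with
  \<open>x = t / (z - t)\<close> of modulus at most 4. The product expands to
  \<open>1 + x + y + x * y\<close>, whence 6 = 1 + 1 + 4.\<close>

lemma
  assumes z: "z \<in> truncated_cone 2 R" and w: "w \<in> truncated_cone 2 R" and R: "R > 0"
  shows cauchy_transform_asymp: "norm (z * cauchy_transform M z - 1) \<le> cone_tail M R"
    and cauchy_transform_diff: "cauchy_transform M z - cauchy_transform M w =
      (w - z) * (LINT t|M. 1 / ((z - complex_of_real t) * (w - complex_of_real t)))"
    and resolvent_product_asymp:
      "norm (z * w * (LINT t|M. 1 / ((z - complex_of_real t) * (w - complex_of_real t))) - 1) \<le> 6 * cone_tail M R"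
proof -
  have nz: "z - complex_of_real t \<noteq> 0" "w - complex_of_real t \<noteq> 0" for t
    using z w R by (auto simp: truncated_cone_def complex_eq_iff)
  have pos: "Im z > 0" "Im w > 0" "R < Im z" "R < Im w" using z w R by (auto simp: truncated_cone_def)
  have far: "R \<le> norm (z - complex_of_real t)" "R \<le> norm (w - complex_of_real t)" for t
    using Im_le_norm_resolvent[of z t] Im_le_norm_resolvent[of w t] pos by linarith+
  note int = integrable_resolvent_upper[OF pos(1)] integrable_resolvent_upper[OF pos(2)]
  have int2: "integrable M (\<lambda>t. 1 / ((z - complex_of_real t) * (w - complex_of_real t)))"
  proof (rule integrable_const_bound[where B = "1 / (R * R)"])
    have "norm (1 / ((z - complex_of_real t) * (w - complex_of_real t))) \<le> 1 / (R * R)" for t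
    proof -
      have "R * R \<le> norm (z - complex_of_real t) * norm (w - complex_of_real t)"
        using far[of t] R by (intro mult_mono) auto
      then show ?thesis
        using nz[of t] R unfolding norm_divide norm_mult norm_one by (intro divide_left_mono mult_pos_pos) auto
    qed
    then show "AE t in M. norm (1 / ((z - complex_of_real t) * (w - complex_of_real t))) \<le> 1 / (R * R)" by simp
  qed measurable
  define x y where "x t = complex_of_real t / (z - complex_of_real t)"
    and "y t = complex_of_real t / (w - complex_of_real t)" for t
  have xy: "norm (x t) \<le> min 4 (\<bar>t\<bar> / \<bar>R\<bar>)" "norm (y t) \<le> min 4 (\<bar>t\<bar> / \<bar>R\<bar>)" for t
    unfolding x_def y_def by (rule resolvent_in_cone[OF z R] resolvent_in_cone[OF w R])+
  have z1: "z * (1 / (z - complex_of_real t)) = 1 + x t" "w * (1 / (w - complex_of_real t)) = 1 + y t" for t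
    using nz[of t] by (auto simp: x_def y_def field_simps)
  show "norm (z * cauchy_transform M z - 1) \<le> cone_tail M R"
  proof -
    have "z * cauchy_transform M z - 1 = (LINT t|M. z * (1 / (z - complex_of_real t)) - 1)"
      unfolding cauchy_transform_def using int(1)
      by (subst Bochner_Integration.integral_diff) (auto simp del: times_divide_eq_right)
    also have "norm \<dots> \<le> (LINT t|M. norm (z * (1 / (z - complex_of_real t)) - 1))"
      by (rule integral_norm_bound)
    also have "\<dots> \<le> (LINT t|M. min 4 (\<bar>t\<bar> / \<bar>R\<bar>))"
    proof (rule integral_mono)
      show "integrable M (\<lambda>t. norm (z * (1 / (z - complex_of_real t)) - 1))"
        using int(1) by (intro integrable_norm Bochner_Integration.integrable_diff integrable_mult_right) auto
      show "norm (z * (1 / (z - complex_of_real t)) - 1) \<le> min 4 (\<bar>t\<bar> / \<bar>R\<bar>)" for t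
        unfolding z1 using xy(1)[of t] by simp
    qed (rule integrable_cone_tail)
    finally show ?thesis by (simp add: cone_tail_def)
  qed
  show "cauchy_transform M z - cauchy_transform M w =
      (w - z) * (LINT t|M. 1 / ((z - complex_of_real t) * (w - complex_of_real t)))"
  proof -
    have "cauchy_transform M z - cauchy_transform M w =
        (LINT t|M. 1 / (z - complex_of_real t) - 1 / (w - complex_of_real t))"
      unfolding cauchy_transform_def using int by (rule Bochner_Integration.integral_diff[symmetric])
    also have "\<dots> = (LINT t|M. (w - z) * (1 / ((z - complex_of_real t) * (w - complex_of_real t))))"
      using nz by (intro Bochner_Integration.integral_cong) (auto simp: diff_frac_eq)
    finally show ?thesis by (simp only: integral_mult_right_zero)
  qed
  show "norm (z * w * (LINT t|M. 1 / ((z - complex_of_real t) * (w - complex_of_real t))) - 1) \<le> 6 * cone_tail M R"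
  proof -
    have eq: "z * w * (1 / ((z - complex_of_real t) * (w - complex_of_real t))) - 1 = x t + y t + x t * y t" for t
    proof -
      have "z * w * (1 / ((z - complex_of_real t) * (w - complex_of_real t))) = (1 + x t) * (1 + y t)"
        unfolding z1[symmetric] by simp
      then show ?thesis by (simp add: algebra_simps)
    qed
    have bound: "norm (x t + y t + x t * y t) \<le> 6 * min 4 (\<bar>t\<bar> / \<bar>R\<bar>)" for t
    proof -
      have "norm (x t * y t) \<le> 4 * min 4 (\<bar>t\<bar> / \<bar>R\<bar>)"
        unfolding norm_mult using xy[of t] by (intro mult_mono) auto
      then have "norm (x t) + norm (y t) + norm (x t * y t) \<le> 6 * min 4 (\<bar>t\<bar> / \<bar>R\<bar>)"
        using xy[of t] by linarith
      then show ?thesis using norm_triangle_ineq[of "x t + y t" "x t * y t"] norm_triangle_ineq[of "x t" "y t"] by linarith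
    qed
    have "z * w * (LINT t|M. 1 / ((z - complex_of_real t) * (w - complex_of_real t))) - 1 =
        (LINT t|M. z * w * (1 / ((z - complex_of_real t) * (w - complex_of_real t))) - 1)"
      using int2 by (subst Bochner_Integration.integral_diff) (auto simp del: times_divide_eq_right)
    also have "norm \<dots> \<le> (LINT t|M. norm (z * w * (1 / ((z - complex_of_real t) * (w - complex_of_real t))) - 1))"
      by (rule integral_norm_bound)
    also have "\<dots> \<le> (LINT t|M. 6 * min 4 (\<bar>t\<bar> / \<bar>R\<bar>))"
    proof (rule integral_mono)
      show "integrable M (\<lambda>t. norm (z * w * (1 / ((z - complex_of_real t) * (w - complex_of_real t))) - 1))"
        using int2 by (intro integrable_norm Bochner_Integration.integrable_diff integrable_mult_right) auto
    qed (use bound integrable_cone_tail in \<open>auto simp only: eq intro: integrable_mult_right\<close>)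
    finally show ?thesis by (simp add: cone_tail_def)
  qed
qed

lemma recip_cauchy_transform_asymp:
  assumes z: "z \<in> truncated_cone 2 R" and R: "R > 0" and small: "cone_tail M R \<le> 1 / 10"
  shows "cauchy_transform M z \<noteq> 0"
    and "norm (recip_cauchy_transform M z - z) \<le> 10 / 9 * cone_tail M R * norm z"
proof -
  define g where "g = z * cauchy_transform M z"
  have g: "norm (g - 1) \<le> cone_tail M R" unfolding g_def by (rule cauchy_transform_asymp[OF z z R])
  have tail: "0 \<le> cone_tail M R" using norm_ge_zero g by (rule order_trans)
  have "norm (1 :: complex) \<le> norm g + norm (g - 1)"
    using norm_triangle_ineq4[of g "g - 1"] by simp
  then have g9: "9 / 10 \<le> norm g" using g small by simp
  then show nz: "cauchy_transform M z \<noteq> 0" by (auto simp: g_def)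
  have z0: "z \<noteq> 0" using g9 by (auto simp: g_def)
  have "recip_cauchy_transform M z - z = z * ((1 - g) / g)"
    using nz z0 by (simp add: recip_cauchy_transform_def g_def field_simps)
  then have "norm (recip_cauchy_transform M z - z) = norm z * (norm (g - 1) / norm g)"
    by (simp add: norm_mult norm_divide norm_minus_commute)
  also have "\<dots> \<le> norm z * (cone_tail M R / (9 / 10))"
    using g g9 tail by (intro mult_left_mono frac_le) auto
  finally show "norm (recip_cauchy_transform M z - z) \<le> 10 / 9 * cone_tail M R * norm z"
    by (simp add: mult_ac)
qed

lemma holomorphic_cauchy_transform_upper: "cauchy_transform M holomorphic_on {z. Im z > 0}"
  by (rule holomorphic_on_subset[OF holomorphic_cauchy_transform[of UNIV]]) auto

text \<open>Nontangentially \<open>F(z) - z = o(z)\<close>, so \<open>F\<close> is injective on a truncated cone, and by Brouwer's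
  fixed point theorem applied to \<open>\<zeta> \<mapsto> w - (F(\<zeta>) - \<zeta>)\<close> its image contains a smaller one.\<close>

theorem voiculescu_transform_exists:
  obtains \<beta> \<phi> where "\<beta> > 0" "is_voiculescu_transform M 1 \<beta> \<phi>"
proof -
  let ?F = "recip_cauchy_transform M" and ?T = "cone_tail M"
  have "eventually (\<lambda>R. ?T R < 1 / 10) at_top"
    using tendsto_cone_tail by (rule order_tendstoD) simp
  then have "eventually (\<lambda>R. \<forall>R'\<ge>R. ?T R' < 1 / 10) at_top"
    by (rule eventually_all_ge_at_top)
  then obtain R0 where R0: "\<And>R. R \<ge> R0 \<Longrightarrow> ?T R < 1 / 10"
    by (auto simp: eventually_at_top_linorder)
  define R where "R = max 1 R0"
  have R: "R > 0" "\<And>R'. R' \<ge> R \<Longrightarrow> ?T R' < 1 / 10" using R0 by (auto simp: R_def)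
  define V where "V = truncated_cone 2 R"
  have Vpos: "Im z > 0" if "z \<in> V" for z using that R(1) by (auto simp: V_def truncated_cone_def)
  have asymp: "norm (?F z - z) \<le> 10 / 9 * ?T R' * norm z" if "z \<in> truncated_cone 2 R'" "R' \<ge> R" for z R'
    using recip_cauchy_transform_asymp(2)[OF that(1)] R(1) R(2)[of R'] that(2) by simp
  have nzV: "cauchy_transform M z \<noteq> 0" if "z \<in> V" for z
    using recip_cauchy_transform_asymp(1)[of z R] that R(1) R(2)[of R] by (simp add: V_def)
  have holF: "?F holomorphic_on V"
    unfolding recip_cauchy_transform_def using nzV
    by (intro holomorphic_intros holomorphic_on_subset[OF holomorphic_cauchy_transform_upper]) (auto dest: Vpos)
  have inj: "inj_on ?F V"
  proof (rule inj_onI)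
    fix z w assume zw: "z \<in> V" "w \<in> V" "?F z = ?F w"
    then have "cauchy_transform M z - cauchy_transform M w = 0"
      using nzV by (simp add: recip_cauchy_transform_def)
    then have 0: "(w - z) * (LINT t|M. 1 / ((z - complex_of_real t) * (w - complex_of_real t))) = 0"
      using cauchy_transform_diff[of z R w] zw R(1) by (simp add: V_def)
    \<comment> \<open>The tail is below 1/10, so the distance is below 6/10 and the divided
      difference of the Cauchy transform cannot vanish.\<close>
    have "norm (z * w * (LINT t|M. 1 / ((z - complex_of_real t) * (w - complex_of_real t))) - 1) < 1"
      using resolvent_product_asymp[of z R w] zw R(1) R(2)[of R] by (simp add: V_def)
    then have "(LINT t|M. 1 / ((z - complex_of_real t) * (w - complex_of_real t))) \<noteq> 0" by auto
    with 0 show "z = w" by simp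
  qed
  obtain g where g: "g holomorphic_on ?F ` V" "\<And>z. z \<in> V \<Longrightarrow> g (?F z) = z"
    using holomorphic_has_inverse[OF holF open_truncated_cone[of 2 R, folded V_def] inj] by metis
  \<comment> \<open>Half the aperture and twice the height of \<open>V\<close>: in \<open>C\<close>
    the norm of \<open>w\<close> is below \<open>2 * Im w\<close>, so the ball of radius
    \<open>norm w / 8\<close> about \<open>w\<close> stays in \<open>V\<close>.\<close>
  define C where "C = truncated_cone 1 (2 * R)"
  have near: "Im w / 2 < Im x" "\<bar>Re x\<bar> < 2 * Im x" "norm w / 4 < Im x" "norm x \<le> 9 / 8 * norm w"
    if w: "w \<in> C" and x: "x \<in> cball w (norm w / 8)" for w x
  proof -
    have w': "2 * R < Im w" "\<bar>Re w\<bar> < Im w" using w by (auto simp: C_def truncated_cone_def)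
    have nw: "norm w < 2 * Im w" using cmod_le[of w] w' R(1) by linarith
    have d: "norm (w - x) \<le> norm w / 8" using x by (simp add: dist_norm)
    have "\<bar>Re (w - x)\<bar> \<le> norm w / 8" "\<bar>Im (w - x)\<bar> \<le> norm w / 8"
      using abs_Re_le_cmod[of "w - x"] abs_Im_le_cmod[of "w - x"] d by linarith+
    then have "Re w - Re x \<le> norm w / 8" "Re x - Re w \<le> norm w / 8" "Im w - Im x \<le> norm w / 8"
      unfolding minus_complex.sel abs_le_iff by linarith+
    then show "Im w / 2 < Im x" "\<bar>Re x\<bar> < 2 * Im x" "norm w / 4 < Im x"
      using w' nw R(1) unfolding abs_less_iff by linarith+
    show "norm x \<le> 9 / 8 * norm w"
      using norm_triangle_ineq4[of w "w - x"] d by simp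
  qed
  have inV: "x \<in> V" if "w \<in> C" "x \<in> cball w (norm w / 8)" for w x
    using near[OF that] that(1) by (auto simp: V_def C_def truncated_cone_def)
  have fixp: "\<exists>x\<in>cball w (norm w / 8). ?F x = w" if w: "w \<in> C" for w
  proof -
    let ?K = "cball w (norm w / 8)"
    have KV: "?K \<subseteq> V" using inV[OF w] by blast
    obtain x where x: "x \<in> ?K" "w - (?F x - x) = x"
    proof (rule brouwer[of ?K "\<lambda>x. w - (?F x - x)"])
      show "continuous_on ?K (\<lambda>x. w - (?F x - x))"
        by (intro continuous_intros holomorphic_on_imp_continuous_on holomorphic_on_subset[OF holF KV])
      \<comment> \<open>The constants fit exactly: 10/9 * 1/10 * 9/8 = 1/8.\<close>
      show "(\<lambda>x. w - (?F x - x)) \<in> ?K \<rightarrow> ?K"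
      proof
        fix x assume x: "x \<in> ?K"
        have "norm (?F x - x) \<le> 10 / 9 * ?T R * norm x"
          using asymp[of x R] inV[OF w x] by (simp add: V_def)
        also have "\<dots> \<le> 10 / 9 * (1 / 10) * norm x"
          using R(2)[of R] by (intro mult_right_mono mult_left_mono) auto
        also have "\<dots> \<le> norm w / 8" using near(4)[OF w x] by simp
        finally show "w - (?F x - x) \<in> ?K" by (simp add: dist_norm)
      qed
    qed auto
    from x(2) have "?F x = w" by (simp add: algebra_simps)
    with x(1) show ?thesis by blast
  qed
  have gx: "g w \<in> cball w (norm w / 8)" "?F (g w) = w" if w: "w \<in> C" for w
  proof -
    obtain x where x: "x \<in> cball w (norm w / 8)" "?F x = w" using fixp[OF w] by blast
    then have "g w = x" using g(2)[OF inV[OF w x(1)]] by simp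
    with x show "g w \<in> cball w (norm w / 8)" "?F (g w) = w" by auto
  qed
  have CF: "C \<subseteq> ?F ` V"
  proof
    fix w assume w: "w \<in> C"
    show "w \<in> ?F ` V" using gx[OF w] inV[OF w gx(1)[OF w]] by (metis image_eqI)
  qed
  define \<phi> where "\<phi> w = g w - w" for w
  \<comment> \<open>The tail is taken at \<open>norm w / 4\<close>, a height that \<open>g w\<close>
    exceeds, instead of \<open>R\<close>; it then tends to 0 and gives
    \<open>\<phi> w = o(w)\<close>.\<close>
  have bound: "norm (\<phi> w / w) \<le> 5 / 4 * ?T (norm w / 4)" if w: "w \<in> C" "norm w \<ge> 4 * R" for w
  proof -
    have gw: "g w \<in> cball w (norm w / 8)" using gx[OF w(1)] by blast
    have w0: "norm w > 0" using w(2) R(1) by linarith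
    have "g w \<in> truncated_cone 2 (norm w / 4)"
      using near[OF w(1) gw] by (simp add: truncated_cone_def)
    then have "norm (?F (g w) - g w) \<le> 10 / 9 * ?T (norm w / 4) * norm (g w)"
      by (rule asymp) (use w(2) in simp)
    also have "\<dots> \<le> 10 / 9 * ?T (norm w / 4) * (9 / 8 * norm w)"
    proof (rule mult_left_mono[OF near(4)[OF w(1) gw]])
      have "0 \<le> ?T (norm w / 4)" unfolding cone_tail_def by (rule integral_nonneg_AE) simp
      then show "0 \<le> 10 / 9 * ?T (norm w / 4)" by simp
    qed
    finally have "norm (\<phi> w) \<le> 5 / 4 * ?T (norm w / 4) * norm w"
      using gx(2)[OF w(1)] by (simp add: \<phi>_def norm_minus_commute mult_ac)
    then show ?thesis using w0 by (simp add: norm_divide pos_divide_le_eq)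
  qed
  have lim: "((\<lambda>w. \<phi> w / w) \<longlongrightarrow> 0) (inf at_infinity (principal C))"
  proof (rule Lim_null_comparison)
    have "eventually (\<lambda>w::complex. 4 * R \<le> norm w) at_infinity"
      by (auto simp: eventually_at_infinity)
    then show "eventually (\<lambda>w. norm (\<phi> w / w) \<le> 5 / 4 * ?T (norm w / 4)) (inf at_infinity (principal C))"
      unfolding eventually_inf_principal by eventually_elim (use bound in auto)
    have "filterlim (\<lambda>w::complex. norm w * (1 / 4)) at_top at_infinity"
      by (rule filterlim_at_top_mult_tendsto_pos[OF tendsto_const _ filterlim_norm_at_top]) simp
    then have "((\<lambda>w::complex. ?T (norm w * (1 / 4))) \<longlongrightarrow> 0) at_infinity"
      by (rule filterlim_compose[OF tendsto_cone_tail])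
    then have "((\<lambda>w::complex. 5 / 4 * ?T (norm w / 4)) \<longlongrightarrow> 5 / 4 * 0) at_infinity"
      by (intro tendsto_mult tendsto_const) simp
    then show "((\<lambda>w::complex. 5 / 4 * ?T (norm w / 4)) \<longlongrightarrow> 0) (inf at_infinity (principal C))"
      by (auto intro: tendsto_mono[OF inf_le1])
  qed
  have "is_voiculescu_transform M 1 (2 * R) \<phi>"
    unfolding is_voiculescu_transform_def C_def[symmetric]
  proof (intro conjI ballI lim)
    show "\<phi> holomorphic_on C"
      unfolding \<phi>_def by (intro holomorphic_intros holomorphic_on_subset[OF g(1) CF])
    fix w assume w: "w \<in> C"
    show "Im (w + \<phi> w) > 0" using Vpos[OF inV[OF w gx(1)[OF w]]] by (simp add: \<phi>_def)
    show "?F (w + \<phi> w) = w" using gx(2)[OF w] by (simp add: \<phi>_def)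
  qed
  then show ?thesis using that[of "2 * R" \<phi>] R(1) by simp
qed

section \<open>Translation and convolution with a point mass\<close>

lemma real_distribution_shift: "real_distribution (distr M borel (\<lambda>t. t + c))"
proof -
  have "prob_space (distr M borel (\<lambda>t. t + c))" by (rule prob_space_distr) simp
  then show ?thesis by (simp add: real_distribution_def real_distribution_axioms_def)
qed

lemma cauchy_transform_shift:
  "cauchy_transform (distr M borel (\<lambda>t. t + c)) z = cauchy_transform M (z - complex_of_real c)"
  unfolding cauchy_transform_def by (subst integral_distr) (simp_all add: algebra_simps)

end

lemma cauchy_transform_return: "cauchy_transform (return borel c) z = 1 / (z - complex_of_real c)"
  unfolding cauchy_transform_def by (subst integral_return) simp_all

lemma voiculescu_transform_return:
  assumes "is_voiculescu_transform (return borel c) \<alpha> \<beta> \<phi>" "z \<in> truncated_cone \<alpha> \<beta>"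
  shows "\<phi> z = complex_of_real c"
proof -
  have "recip_cauchy_transform (return borel c) (z + \<phi> z) = z"
    using assms by (auto simp: is_voiculescu_transform_def)
  then show ?thesis by (simp add: recip_cauchy_transform_def cauchy_transform_return algebra_simps)
qed

lemma tendsto_const_divide_at_infinity:
  "((\<lambda>z::complex. c / z) \<longlongrightarrow> 0) (inf at_infinity (principal S))"
  by (rule tendsto_mono[OF inf_le1]) (auto intro!: tendsto_divide_0 filterlim_ident)

text \<open>The translate has reciprocal Cauchy transform F(z - c), so adding \<open>c\<close> to a
  Voiculescu transform of \<open>\<mu>\<close> gives one for it. A competitor agrees with the
  translate on the image of a cone; the identity theorem and Stieltjes inversion do the
  rest.\<close>

theorem free_add_conv_return:
  assumes "real_distribution \<mu>"
  shows "free_add_conv (return borel c) \<mu> = distr \<mu> borel (\<lambda>t. t + c)"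
proof -
  interpret real_distribution \<mu> by fact
  let ?\<tau> = "distr \<mu> borel (\<lambda>t. t + c)"
  have F\<tau>: "recip_cauchy_transform ?\<tau> z = recip_cauchy_transform \<mu> (z - complex_of_real c)" for z
    by (simp add: recip_cauchy_transform_def cauchy_transform_shift)
  show ?thesis
    unfolding free_add_conv_def
  proof (rule the_equality)
    obtain \<beta> \<phi> where \<phi>: "\<beta> > 0" "is_voiculescu_transform \<mu> 1 \<beta> \<phi>" by (rule voiculescu_transform_exists)
    have "is_voiculescu_transform (return borel c) 1 \<beta> (\<lambda>z. complex_of_real c)"
      using \<phi>(1) tendsto_const_divide_at_infinity
      by (auto simp: is_voiculescu_transform_def truncated_cone_def recip_cauchy_transform_def cauchy_transform_return)
    moreover have "is_voiculescu_transform ?\<tau> 1 \<beta> (\<lambda>z. complex_of_real c + \<phi> z)"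
      unfolding is_voiculescu_transform_def
    proof (intro conjI ballI)
      show "(\<lambda>z. complex_of_real c + \<phi> z) holomorphic_on truncated_cone 1 \<beta>"
        using \<phi>(2) by (auto simp: is_voiculescu_transform_def intro!: holomorphic_intros)
      have "((\<lambda>z. complex_of_real c / z + \<phi> z / z) \<longlongrightarrow> 0 + 0) (inf at_infinity (principal (truncated_cone 1 \<beta>)))"
        using \<phi>(2) by (intro tendsto_add tendsto_const_divide_at_infinity) (simp add: is_voiculescu_transform_def)
      then show "((\<lambda>z. (complex_of_real c + \<phi> z) / z) \<longlongrightarrow> 0) (inf at_infinity (principal (truncated_cone 1 \<beta>)))"
        by (simp add: add_divide_distrib)
      fix z assume z: "z \<in> truncated_cone 1 \<beta>"
      show "Im (z + (complex_of_real c + \<phi> z)) > 0"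
        using \<phi>(2) z by (auto simp: is_voiculescu_transform_def)
      have "z + (complex_of_real c + \<phi> z) - complex_of_real c = z + \<phi> z" by simp
      then show "recip_cauchy_transform ?\<tau> (z + (complex_of_real c + \<phi> z)) = z"
        using \<phi>(2) z unfolding F\<tau> by (simp add: is_voiculescu_transform_def)
    qed
    ultimately show "real_distribution ?\<tau> \<and> (\<exists>\<alpha> \<beta> \<phi> \<psi>. \<alpha> > 0 \<and> \<beta> > 0 \<and>
        is_voiculescu_transform (return borel c) \<alpha> \<beta> \<phi> \<and> is_voiculescu_transform \<mu> \<alpha> \<beta> \<psi> \<and>
        is_voiculescu_transform ?\<tau> \<alpha> \<beta> (\<lambda>z. \<phi> z + \<psi> z))"
      using \<phi> real_distribution_shift
      by (intro conjI exI[of _ 1] exI[of _ \<beta>] exI[of _ "\<lambda>z. complex_of_real c"] exI[of _ \<phi>]) auto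
  next
    fix \<rho> assume "real_distribution \<rho> \<and> (\<exists>\<alpha> \<beta> \<phi> \<psi>. \<alpha> > 0 \<and> \<beta> > 0 \<and>
        is_voiculescu_transform (return borel c) \<alpha> \<beta> \<phi> \<and> is_voiculescu_transform \<mu> \<alpha> \<beta> \<psi> \<and>
        is_voiculescu_transform \<rho> \<alpha> \<beta> (\<lambda>z. \<phi> z + \<psi> z))"
    then obtain \<alpha> \<beta> \<phi> \<psi> where \<rho>: "real_distribution \<rho>" and pos: "\<alpha> > 0" "\<beta> > 0"
      and V: "is_voiculescu_transform (return borel c) \<alpha> \<beta> \<phi>" "is_voiculescu_transform \<mu> \<alpha> \<beta> \<psi>"
        "is_voiculescu_transform \<rho> \<alpha> \<beta> (\<lambda>z. \<phi> z + \<psi> z)" by blast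
    let ?C = "truncated_cone \<alpha> \<beta>"
    define h where "h z = z + (complex_of_real c + \<psi> z)" for z
    have h: "Im (h z) > 0" "recip_cauchy_transform \<rho> (h z) = z" "recip_cauchy_transform ?\<tau> (h z) = z" if "z \<in> ?C" for z
    proof -
      have "\<phi> z = complex_of_real c" using V(1) that by (rule voiculescu_transform_return)
      then show "Im (h z) > 0" "recip_cauchy_transform \<rho> (h z) = z"
        using V(3) that by (auto simp: is_voiculescu_transform_def h_def)
      have "h z - complex_of_real c = z + \<psi> z" by (simp add: h_def)
      then show "recip_cauchy_transform ?\<tau> (h z) = z"
        using V(2) that by (auto simp: is_voiculescu_transform_def F\<tau>)
    qed
    show "\<rho> = ?\<tau>"
    proof (rule cauchy_transform_unique[OF \<rho> real_distribution_shift])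
      fix z :: complex assume z: "Im z > 0"
      show "cauchy_transform \<rho> z = cauchy_transform ?\<tau> z"
      proof (rule analytic_continuation_open[of "h ` ?C" "{z. Im z > 0}" "cauchy_transform \<rho>" "cauchy_transform ?\<tau>"])
        \<comment> \<open>The reciprocal Cauchy transform is a left inverse of \<open>h\<close>, so
          \<open>h\<close> is injective and the open mapping theorem applies to its image.\<close>
        show "open (h ` ?C)"
        proof (rule open_mapping_thm3)
          show "h holomorphic_on ?C"
            unfolding h_def using V(2) by (auto simp: is_voiculescu_transform_def intro!: holomorphic_intros)
          show "inj_on h ?C" using h(3) by (metis inj_onI)
        qed (rule open_truncated_cone)
        show "open {z. Im z > 0}" by (rule open_halfspace_Im_gt)
        have "Complex 0 (\<beta> + 1) \<in> ?C" using pos by (simp add: truncated_cone_def)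
        then show "h ` ?C \<noteq> {}" by blast
        show "connected {z. Im z > 0}" by (intro convex_connected convex_halfspace_Im_gt)
        show "h ` ?C \<subseteq> {z. Im z > 0}" using h(1) by auto
        show "cauchy_transform \<rho> holomorphic_on {z. Im z > 0}"
          by (rule real_distribution.holomorphic_cauchy_transform_upper[OF \<rho>])
        show "cauchy_transform ?\<tau> holomorphic_on {z. Im z > 0}"
          by (rule real_distribution.holomorphic_cauchy_transform_upper[OF real_distribution_shift])
        fix y assume "y \<in> h ` ?C"
        then obtain x where x: "x \<in> ?C" "y = h x" by blast
        then have "recip_cauchy_transform \<rho> y = recip_cauchy_transform ?\<tau> y" using h by simp
        then have "1 / recip_cauchy_transform \<rho> y = 1 / recip_cauchy_transform ?\<tau> y" by simp
        then show "cauchy_transform \<rho> y = cauchy_transform ?\<tau> y"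
          unfolding recip_cauchy_transform_def by simp
      qed (use z in simp)
    qed
  qed
qed

theorem proposition3p6:
  fixes a b :: real
  assumes "a \<ge> 1" and "b \<ge> 1"
  shows "(\<forall>n\<ge>1. hyp_poly n a b =
            finite_free_mult n (hyp_poly n a (a + b))
              (finite_free_add n (finite_free_unit n) (hyp_poly n a b)))
    \<and> (\<forall>n\<ge>1. \<forall>z. poly (hyp_poly n a (a + b)) z = 0 \<longrightarrow> z \<in> \<real>)
    \<and> weak_conv_m (\<lambda>n. root_distribution (hyp_poly n a (a + b))) (free_beta_prime a (a + b))
    \<and> (\<forall>n\<ge>1. \<forall>z. poly (hyp_poly n a b) z = 0 \<longrightarrow> z \<in> \<real>)
    \<and> weak_conv_m (\<lambda>n. root_distribution (hyp_poly n a b)) (free_beta_prime a b)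
    \<and> free_beta_prime a b =
        free_mult_conv (free_beta_prime a (a + b))
          (free_add_conv (return borel 1) (free_beta_prime a b))"
proof -
  have ab: "a > 0" "a + b \<ge> 1" using assms by simp_all
  have add: "free_add_conv (return borel 1) (free_beta_prime a b) = distr (free_beta_prime a b) borel (\<lambda>t. t + 1)"
    using free_add_conv_return[of "free_beta_prime a b" 1] nonneg_free_beta_prime[OF assms]
    by (simp add: nonneg_distribution_def)
  \<comment> \<open>For real roots the projection \<open>Re\<close> in
    \<open>root_distribution\<close> moves nothing, so the measures are the empirical root
    distributions.\<close>
  have real: "z \<in> \<real>" if "c \<ge> 1" "n \<ge> 1" "poly (hyp_poly n a c) z = 0" for n c z
    using hyp_poly_roots[OF assms(1) that] by auto
  show ?thesis
    unfolding add free_mult_conv_free_beta_prime[OF assms]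
    using hyp_poly_finite_free[OF ab(1) assms(2)] real[OF ab(2)] real[OF assms(2)]
      weak_conv_free_beta_prime[OF assms(1) ab(2)] weak_conv_free_beta_prime[OF assms]
    by blast
qed

end
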